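(* For a positive integer $n$, let $r_{m,t}(n)$ be the number of pairs $(a,b)$ of positive integers with $a\ge b$, $a+b=n$, and $ab=t\,P(m,c)$ for some admissible integer $c$. Then for every positive integer $n$: 1. $r_{3,1}(n)=\lfloor \{d(2n^2+1)-1\}/2 \rfloor$; 2. $r_{5,1}(n)=\lfloor \{d(6n^2+1)-1\}/2 \rfloor$; 3. $r_{7,1}(n)=\lfloor \{d_{\{3\}}(10n^2+9)-1\}/2 \rfloor$; 4. $r_{13,1}(n)=\lfloor \{d_{\{3\}}(22n^2+81)-1\}/2 \rfloor$; 5. $r_{31,1}(n)=\lfloor \{d_{\{3\}}(58n^2+729)-1\}/2 \rfloor$; 6. $r_{3,2}(n)=d(n^2+1)/2-1$; 7. $r_{8,2}(n)=\lfloor \{d_{\{2\}}(3n^2+8)-1\}/2 \rfloor$; 8. $r_{12,2}(n)=\lfloor \{d_{\{2\}}(5n^2+32)-1\}/2 \rfloor$; 9. $r_{24,2}(n)=\lfloor \{d_{\{2,5\}}(11n^2+200)-1\}/2 \rfloor$; 10. $r_{60,2}(n)=\lfloor \{d_{\{2,7\}}(29n^2+1568)-1\}/2 \rfloor$; 11. $r_{3,3}(n)=\lfloor \{d_{\{3\}}(2n^2+3)-1\}/2 \rfloor$; 12. $r_{3,5}(n)=\lfloor \{d_{\{5\}}(2n^2+5)-1\}/2 \rfloor$; 13. $r_{3,11}(n)=\lfloor \{d_{\{11\}}(2n^2+11)-1\}/2 \rfloor$; 14. $r_{3,29}(n)=\lfloor \{d_{\{29\}}(2n^2+29)-1\}/2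 \rfloor$.
   Context: For an integer $m\ge3$, $P(m,c)=\frac{c}{2}\{(m-2)c-(m-4)\}$ is the $c$-th $m$-gonal number; "admissible" means $c$ is a positive integer when $m\in\{3,4\}$ and any integer when $m>4$. For a prime $p$ and positive integer $N$, $ord_p(N)$ is the exponent with $p^{ord_p(N)}\,\|\,N$. For a set $A$ of primes, $d_A(N)=\prod_{p\notin A}(1+ord_p N)$ (product over primes not in $A$), so $d_\varnothing(N)=d(N)$ is the number of positive divisors of $N$. *)

theory Defs
  imports Complex_Main "HOL-Computational_Algebra.Computational_Algebra"
begin

definition polygonal :: "nat \<Rightarrow> int \<Rightarrow> int" where
  "polygonal m c = c * ((int m - 2) * c - (int m - 4)) div 2"

text \<open>The division by two is exact:\<close>

lemma of_int_polygonal: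
  "real_of_int (polygonal m c) = of_int c / 2 * ((of_nat m - 2) * of_int c - (of_nat m - 4))"
proof -
  have *: "c * ((int m - 2) * c - (int m - 4)) = (int m - 2) * (c * (c - 1)) + 2 * c"
    by (simp add: algebra_simps)
  have "even (c * ((int m - 2) * c - (int m - 4)))"
    unfolding * by simp
  then have "2 * polygonal m c = c * ((int m - 2) * c - (int m - 4))"
    unfolding polygonal_def by simp
  then have "real_of_int (2 * polygonal m c) = of_int (c * ((int m - 2) * c - (int m - 4)))"
    by (rule arg_cong)
  then show ?thesis
    by (simp add: field_simps)
qed

definition admissible :: "nat \<Rightarrow> int \<Rightarrow> bool" where
  "admissible m c \<longleftrightarrow> (m = 3 \<or> m = 4) \<and> c > 0 \<or> m > 4"

definition rep_count :: "nat \<Rightarrow> nat \<Rightarrow> nat \<Rightarrow> nat" where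
  "rep_count m t n = card {(a, b). a > 0 \<and> b > 0 \<and> a \<ge> b \<and> a + b = n \<and>
     (\<exists>c. admissible m c \<and> int (a * b) = int t * polygonal m c)}"

definition ndivisors :: "nat \<Rightarrow> nat" where
  "ndivisors N = card {k. k dvd N}"

text \<open>Primes that do not divide \<open>N\<close> would contribute the factor 1 to the following
  product, so it may be restricted to the finitely many prime factors of \<open>N\<close>.\<close>

definition ndivisors_avoiding :: "nat set \<Rightarrow> nat \<Rightarrow> nat" where
  "ndivisors_avoiding A N = (\<Prod>p\<in>prime_factors N - A. 1 + multiplicity p N)"

end

theory Submission
  imports Defs "HOL-Number_Theory.Residues"
begin

text \<open>Put \<open>x = a - b\<close> and \<open>y = 2 (m - 2) c - (m - 4)\<close>. The condition \<open>a b = t P(m, c)\<close> turns into an equation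
  \<open>y\<^sup>2 + D x\<^sup>2 = M\<close> with \<open>D\<close> one of 1, 2, 6, 10, 22, 58, where congruences make every solution come from some
  \<open>c\<close>, and the trivial solutions \<open>x = \<plusminus>n\<close>, \<open>y = \<plusminus>(m - 4)\<close> and the symmetry in the signs of \<open>x\<close> and \<open>y\<close> account for
  the floor and the \<open>-1\<close>. For these \<open>D\<close> there is one class of forms per genus, so the
  number of representations is proportional to \<open>\<Prod>(1 + ord\<^sub>p)\<close> over the split primes. The latter is proved by a
  Hecke recursion: if \<open>p\<close> splits, \<open>r(p M) + r(M / p) = 2 r(M)\<close>, where \<open>r\<close> counts the representations by the
  two reduced forms together. Ramified primes, and squares of inert ones, do not change \<open>r\<close>. The given
  representation by \<open>(\<plusminus>n, \<plusminus>(m - 4))\<close> shows that inert primes occur to even powers and which genus is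
  relevant.\<close>

section \<open>Representations by \<open>x\<^sup>2 + D * y\<^sup>2\<close> and the Hecke relation\<close>

definition reps :: "int \<Rightarrow> int \<Rightarrow> (int \<times> int) set" where
  "reps D M = {(x, y). x\<^sup>2 + D * y\<^sup>2 = M}"

lemma mem_reps [simp]: "(x, y) \<in> reps D M \<longleftrightarrow> x\<^sup>2 + D * y\<^sup>2 = M"
  by (simp add: reps_def)

lemma abs_le_square_int: "\<bar>x\<bar> \<le> x\<^sup>2" for x :: int
  using self_le_power[of "\<bar>x\<bar>" 2] by (cases "x = 0") auto

lemma finite_reps:
  assumes "D > 0" shows "finite (reps D M)"
proof (rule finite_subset)
  show "reps D M \<subseteq> {-M..M} \<times> {-M..M}"
  proof clarify
    fix x y assume "(x, y) \<in> reps D M"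
    then have M: "x\<^sup>2 + D * y\<^sup>2 = M" by simp
    have "y\<^sup>2 \<le> D * y\<^sup>2" using assms by (simp add: mult_le_cancel_right1)
    with M have "x\<^sup>2 \<le> M" "y\<^sup>2 \<le> M"
      using zero_le_power2[of x] zero_le_power2[of y] by linarith+
    with abs_le_square_int[of x] abs_le_square_int[of y]
    show "x \<in> {-M..M} \<and> y \<in> {-M..M}" by auto
  qed
qed auto

text \<open>Scaling by \<open>q\<close> is injective, and the divisibility hypothesis makes it
  surjective. It is applied with \<open>q = 2\<close> and with inert primes.\<close>

lemma card_reps_square_mult:
  assumes "q > 0" and dvd: "\<And>x y. q\<^sup>2 dvd x\<^sup>2 + D * y\<^sup>2 \<Longrightarrow> q dvd x \<and> q dvd y"
  shows "card (reps D (q\<^sup>2 * M)) = card (reps D M)"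
proof -
  have "bij_betw (\<lambda>(x, y). (q * x, q * y)) (reps D M) (reps D (q\<^sup>2 * M))"
    unfolding bij_betw_def
  proof (intro conjI equalityI subsetI)
    show "inj_on (\<lambda>(x, y). (q * x, q * y)) (reps D M)"
      using assms(1) by (auto intro!: inj_onI)
  next
    fix z assume "z \<in> (\<lambda>(x, y). (q * x, q * y)) ` reps D M"
    then show "z \<in> reps D (q\<^sup>2 * M)" by (auto simp: power_mult_distrib algebra_simps)
  next
    fix z assume "z \<in> reps D (q\<^sup>2 * M)"
    moreover obtain x y where z: "z = (x, y)" by (cases z)
    ultimately have eq: "x\<^sup>2 + D * y\<^sup>2 = q\<^sup>2 * M" by simp
    then obtain x' y' where xy: "x = q * x'" "y = q * y'"
      using dvd[of x y] by (auto elim!: dvdE)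
    with eq have "q\<^sup>2 * (x'\<^sup>2 + D * y'\<^sup>2) = q\<^sup>2 * M"
      by (simp add: power_mult_distrib algebra_simps)
    with \<open>q > 0\<close> have "(x', y') \<in> reps D M" by simp
    then show "z \<in> (\<lambda>(x, y). (q * x, q * y)) ` reps D M"
      using xy z by force
  qed
  then show ?thesis by (simp add: bij_betw_same_card)
qed

lemma four_dvd_form:
  fixes x y D :: int
  assumes "D mod 4 \<in> {1, 2}" "2\<^sup>2 dvd x\<^sup>2 + D * y\<^sup>2"
  shows "2 dvd x \<and> 2 dvd y"
proof -
  have sq: "z\<^sup>2 mod 4 = (if even z then 0 else 1)" for z :: int
  proof (cases "even z")
    case True then show ?thesis by (auto elim!: evenE simp: power_mult_distrib)
  next
    case False
    then obtain w where "z = 2 * w + 1" by (auto elim!: oddE)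
    then have "z\<^sup>2 = 1 + 4 * (w\<^sup>2 + w)" by (simp add: power2_eq_square algebra_simps)
    then show ?thesis using False by presburger
  qed
  have "[x\<^sup>2 + D * y\<^sup>2 = x\<^sup>2 mod 4 + (D mod 4) * (y\<^sup>2 mod 4)] (mod 4)"
    by (intro cong_add cong_mult) (simp_all add: cong_def)
  then have "(x\<^sup>2 + D * y\<^sup>2) mod 4 = (x\<^sup>2 mod 4 + (D mod 4) * (y\<^sup>2 mod 4)) mod 4"
    by (simp only: cong_def)
  with assms show ?thesis unfolding sq by (auto split: if_splits)
qed

lemma card_reps_four_mult:
  assumes "D mod 4 \<in> {1, 2}"
  shows "card (reps D (4 * M)) = card (reps D M)"
  using card_reps_square_mult[of 2 D M] four_dvd_form[OF assms] by simp

text \<open>Multiplication by an element of norm \<open>s p\<close> and by its conjugate embed the representations of \<open>M\<close>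
  into those of \<open>s p M\<close>; the images cover everything and meet in the multiples of \<open>p\<close>.\<close>

lemma hecke_relation:
  fixes D p s u v M :: int
  assumes D: "D > 0" and p: "prime p" "odd p" "\<not> p dvd D"
    and uv: "u\<^sup>2 + D * v\<^sup>2 = s * p" and s: "s = 1 \<or> s = 2 \<and> D mod 4 = 2"
  shows "card (reps D (s * p * M)) + card {(x, y). p * (x\<^sup>2 + D * y\<^sup>2) = s * M} = 2 * card (reps D M)"
proof -
  \<comment> \<open>\<open>f w\<close> multiplies \<open>x + y sqrt(-D)\<close> by
    \<open>u + w sqrt(-D)\<close>; the cases \<open>w = v\<close> and \<open>w = -v\<close> are the
    element of norm \<open>s p\<close> and its conjugate.\<close>
  define f where "f = (\<lambda>w (x, y). (u * x - D * w * y, u * y + w * (x :: int)))"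
  have sq_pos: "s > 0" "p > 0" using s p prime_gt_0_int by auto
  have norm_f: "(x, y) \<in> reps D M \<Longrightarrow> f w (x, y) \<in> reps D (s * p * M)" if "w\<^sup>2 = v\<^sup>2" for w x y
  proof -
    assume "(x, y) \<in> reps D M"
    then have M: "x\<^sup>2 + D * y\<^sup>2 = M" by simp
    have "(u * x - D * w * y)\<^sup>2 + D * (u * y + w * x)\<^sup>2 = (u\<^sup>2 + D * w\<^sup>2) * (x\<^sup>2 + D * y\<^sup>2)"
      by (simp add: power2_eq_square algebra_simps)
    then show ?thesis using M uv that by (simp add: f_def)
  qed
  \<comment> \<open>Multiplying back by \<open>u - w sqrt(-D)\<close> gives \<open>s p\<close> times
    the original, hence injectivity and a test for lying in the image.\<close>
  have inv_f: "u * fst (f w (x, y)) + D * w * snd (f w (x, y)) = s * p * x \<and>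
               u * snd (f w (x, y)) - w * fst (f w (x, y)) = s * p * y" if "w\<^sup>2 = v\<^sup>2" for w x y
  proof -
    have "s * p = u\<^sup>2 + D * w\<^sup>2" using uv that by simp
    then show ?thesis unfolding f_def
      by (simp add: power2_eq_square algebra_simps)
  qed
  have inj: "inj_on (f w) X" if "w\<^sup>2 = v\<^sup>2" for w X
  proof (rule inj_onI, clarify)
    fix x y x' y' assume "f w (x, y) = f w (x', y')"
    then have "s * p * x = s * p * x'" "s * p * y = s * p * y'"
      using inv_f[OF that, of x y] inv_f[OF that, of x' y'] by auto
    then show "x = x' \<and> y = y'" using sq_pos by simp
  qed
  \<comment> \<open>Divisibility by \<open>s\<close> is automatic: if \<open>s = 2\<close>, then
    \<open>D\<close> is even, hence so are \<open>u\<close> and \<open>X\<close>. Only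
    \<open>p\<close> has to be tested.\<close>
  have sdvd: "s dvd u * Y - w * X \<and> s dvd u * X + D * w * Y"
    if w: "w\<^sup>2 = v\<^sup>2" and "X\<^sup>2 + D * Y\<^sup>2 = s * K" for w X Y K
  proof (cases "s = 1")
    case False
    with s have s2: "s = 2" "D mod 4 = 2" by auto
    then have "even D" by presburger
    have "even (u\<^sup>2 + D * v\<^sup>2)" "even (X\<^sup>2 + D * Y\<^sup>2)" using uv that s2 by simp_all
    with \<open>even D\<close> have "even u" "even X" by auto
    then show ?thesis using s2 \<open>even D\<close> by auto
  qed auto
  have cop: "s * p dvd z" if "s dvd z" "p dvd z" for z
  proof -
    have "coprime s p" using s p by (auto simp: coprime_left_2_iff_odd)
    then show ?thesis using that by (simp add: divides_mult)
  qed
  have lift: "(X, Y) \<in> f w ` reps D M"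
    if w: "w\<^sup>2 = v\<^sup>2" and N: "X\<^sup>2 + D * Y\<^sup>2 = s * p * M" and d: "p dvd u * Y - w * X" for w X Y
  proof -
    have "s dvd u * Y - w * X" "s dvd u * X + D * w * Y"
      using sdvd[OF w, of X Y "p * M"] N by (auto simp: mult.assoc)
    have "s * p dvd u * Y - w * X" by (rule cop) fact+
    then obtain y where y: "u * Y - w * X = s * p * y" by (auto elim: dvdE)
    \<comment> \<open>Taking norms shows that the first coordinate is divisible by
      \<open>s p\<close> once the second is.\<close>
    have "(u * X + D * w * Y)\<^sup>2 + D * (u * Y - w * X)\<^sup>2 = (u\<^sup>2 + D * w\<^sup>2) * (X\<^sup>2 + D * Y\<^sup>2)"
      by (simp add: power2_eq_square algebra_simps)
    also have "\<dots> = (s * p)\<^sup>2 * M" using uv w N by (simp add: power2_eq_square)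
    finally have e: "(u * X + D * w * Y)\<^sup>2 = (s * p)\<^sup>2 * (M - D * y\<^sup>2)"
      unfolding y by (simp add: power_mult_distrib algebra_simps)
    then have "(s * p)\<^sup>2 dvd (u * X + D * w * Y)\<^sup>2" by simp
    then have "s * p dvd u * X + D * w * Y" by simp
    then obtain x where x: "u * X + D * w * Y = s * p * x" by (auto elim: dvdE)
    have "(s * p)\<^sup>2 * (M - D * y\<^sup>2) = (s * p)\<^sup>2 * x\<^sup>2"
      using e[symmetric] unfolding x power_mult_distrib[of _ x] .
    then have "(x, y) \<in> reps D M" using sq_pos by simp
    moreover have "f w (x, y) = (X, Y)"
    proof -
      have u: "u\<^sup>2 + D * w\<^sup>2 = s * p" using uv w by simp
      have "s * p * (u * x - D * w * y) = u * (u * X + D * w * Y) - D * w * (u * Y - w * X)"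
        unfolding x y by (simp add: algebra_simps)
      also have "\<dots> = s * p * X" unfolding u[symmetric] by (simp add: power2_eq_square algebra_simps)
      finally have 1: "u * x - D * w * y = X" using sq_pos by simp
      have "s * p * (u * y + w * x) = u * (u * Y - w * X) + w * (u * X + D * w * Y)"
        unfolding x y by (simp add: algebra_simps)
      also have "\<dots> = s * p * Y" unfolding u[symmetric] by (simp add: power2_eq_square algebra_simps)
      finally have "u * y + w * x = Y" using sq_pos by simp
      with 1 show ?thesis by (simp add: f_def)
    qed
    ultimately show ?thesis by (metis imageI)
  qed
  have union: "f v ` reps D M \<union> f (-v) ` reps D M = reps D (s * p * M)"
  proof (intro equalityI subsetI)
    fix z assume "z \<in> f v ` reps D M \<union> f (-v) ` reps D M"
    then show "z \<in> reps D (s * p * M)" using norm_f[of v] norm_f[of "-v"] by auto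
  next
    fix z assume z: "z \<in> reps D (s * p * M)"
    obtain X Y where zXY: "z = (X, Y)" by (cases z)
    with z have N: "X\<^sup>2 + D * Y\<^sup>2 = s * p * M" by simp
    \<comment> \<open>The tests for the two images multiply to a multiple of \<open>p\<close>, so by
      primality every \<open>(X, Y)\<close> passes at least one.\<close>
    have "(u * Y - v * X) * (u * Y - (-v) * X) = (u\<^sup>2 + D * v\<^sup>2) * Y\<^sup>2 - v\<^sup>2 * (X\<^sup>2 + D * Y\<^sup>2)"
      by (simp add: power2_eq_square algebra_simps)
    also have "\<dots> = p * (s * Y\<^sup>2 - v\<^sup>2 * s * M)" unfolding uv N by (simp add: algebra_simps)
    finally have "p dvd (u * Y - v * X) * (u * Y - (-v) * X)" by simp
    then have "p dvd u * Y - v * X \<or> p dvd u * Y - (-v) * X"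
      using p(1) prime_dvd_multD by blast
    then show "z \<in> f v ` reps D M \<union> f (-v) ` reps D M"
      using lift[of v X Y] lift[of "-v" X Y] N zXY by auto
  qed
  have p2: "\<not> p dvd 2"
    using p(1,2) prime_ge_2_int[of p] zdvd_imp_le[of p 2] by (cases "p = 2") auto
  \<comment> \<open>If \<open>p\<close> divided \<open>u\<close>, it would divide \<open>v\<close>
    too, and then \<open>p^2\<close> would divide \<open>s p\<close>, impossible for odd
    \<open>p\<close>.\<close>
  have pu: "\<not> p dvd u"
  proof
    assume "p dvd u"
    then have "p dvd s * p - u\<^sup>2" by (simp add: power2_eq_square)
    then have "p dvd D * v\<^sup>2" using uv by (metis add_diff_cancel_left')
    with p have "p dvd v" by (metis prime_dvd_multD prime_dvd_power)
    with \<open>p dvd u\<close> have "p * p dvd u\<^sup>2 + D * v\<^sup>2"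
      by (simp add: power2_eq_square mult_dvd_mono)
    then have "p dvd s" using uv sq_pos by simp
    with s p p2 show False by auto
  qed
  have pv: "\<not> p dvd v"
  proof
    assume "p dvd v"
    then have "p dvd s * p - D * v\<^sup>2" by (simp add: power2_eq_square)
    then have "p dvd u\<^sup>2" using uv by (metis add_diff_cancel_right')
    with p pu show False by (metis prime_dvd_power)
  qed
  have inter: "f v ` reps D M \<inter> f (-v) ` reps D M =
      (\<lambda>(x, y). (p * x, p * y)) ` {(x, y). p * (x\<^sup>2 + D * y\<^sup>2) = s * M}" (is "?L = ?R")
  proof (intro equalityI subsetI)
    fix z assume z: "z \<in> ?L"
    obtain X Y where zXY: "z = (X, Y)" by (cases z)
    have "z \<in> reps D (s * p * M)" using z union by blast
    then have N: "X\<^sup>2 + D * Y\<^sup>2 = s * p * M" by (simp add: zXY)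
    have "p dvd u * Y - w * X" if w: "w\<^sup>2 = v\<^sup>2" and "z \<in> f w ` reps D M" for w
    proof -
      from that obtain x y where "f w (x, y) = (X, Y)" by (auto simp: zXY)
      then have "u * Y - w * X = s * p * y" using inv_f[OF w, of x y] by simp
      then show ?thesis by simp
    qed
    from this[of v] this[of "-v"] z
    have a: "p dvd u * Y - v * X" and b: "p dvd u * Y + v * X" by auto
    have "p dvd 2 * u * Y" using dvd_add[OF a b] by (simp add: algebra_simps)
    moreover have "p dvd 2 * v * X" using dvd_diff[OF b a] by (simp add: algebra_simps)
    ultimately have "p dvd X" "p dvd Y" using p(1) pu pv p2 by (auto simp: prime_dvd_mult_iff)
    then obtain x y where xy: "X = p * x" "Y = p * y" by (auto elim!: dvdE)
    have "p * (p * (x\<^sup>2 + D * y\<^sup>2)) = p * (s * M)"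
      using N unfolding xy by (simp add: power2_eq_square algebra_simps)
    then have "p * (x\<^sup>2 + D * y\<^sup>2) = s * M" using sq_pos by simp
    then show "z \<in> ?R" using xy zXY by force
  next
    fix z assume "z \<in> ?R"
    then obtain x y where z: "z = (p * x, p * y)" and e: "p * (x\<^sup>2 + D * y\<^sup>2) = s * M" by auto
    have N: "(p * x)\<^sup>2 + D * (p * y)\<^sup>2 = s * p * M"
      using arg_cong[OF e, of "\<lambda>t. p * t"] by (simp add: power2_eq_square algebra_simps)
    have "p dvd u * (p * y) - w * (p * x)" for w by simp
    then show "z \<in> ?L" using lift[of v, OF _ N] lift[of "-v", OF _ N] z by auto
  qed
  have fin: "finite (f w ` reps D M)" for w using finite_reps[OF D] by simp
  have "card (f v ` reps D M) + card (f (-v) ` reps D M) = card (reps D (s * p * M)) + card ?R"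
    using card_Un_Int[OF fin fin, of v "-v"] unfolding union inter .
  moreover have "card (f v ` reps D M) = card (reps D M)" "card (f (-v) ` reps D M) = card (reps D M)"
    by (rule card_image, rule inj, simp)+
  moreover have "card ?R = card {(x, y). p * (x\<^sup>2 + D * y\<^sup>2) = s * M}"
    using sq_pos by (intro card_image) (auto intro!: inj_onI)
  ultimately show ?thesis by simp
qed

section \<open>Reduction of forms\<close>

text \<open>Up to the substitution \<open>x = 2 x'\<close>, solutions of \<open>x\<^sup>2 + D y\<^sup>2 = 2 M\<close> with \<open>D\<close> even are representations
  of \<open>M\<close> by the other form \<open>2 x'\<^sup>2 + (D / 2) y\<^sup>2\<close>. Adding the two counts gives a quantity for which all
  primes, whichever form represents them, obey the same recursion.\<close>

definition nreps :: "int \<Rightarrow> int \<Rightarrow> nat" where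
  "nreps D M = card (reps D M) + card (reps D (2 * M))"

text \<open>For these \<open>D\<close>, every positive form \<open>a X\<^sup>2 + 2 b X Y + c Y\<^sup>2\<close> with \<open>a c - b\<^sup>2 = D\<close> is equivalent to
  \<open>X\<^sup>2 + D Y\<^sup>2\<close> or \<open>2 X\<^sup>2 + (D / 2) Y\<^sup>2\<close>; apart from 1 and 2, these two forms lie in different genera.\<close>

definition genus_discs :: "int set" where
  "genus_discs = {1, 2, 6, 10, 22, 58}"

text \<open>Reducedness gives \<open>3 a^2 <= 4 D <= 232\<close>, so \<open>a <= 8\<close> and
  \<open>\<bar>b\<bar> <= 4\<close>. The finitely many remaining cases are checked one by one; this
  is the enumeration of reduced forms for the six values of \<open>D\<close>.\<close>

lemma form_reduction_base:
  fixes D a b c :: int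
  assumes D: "D \<in> genus_discs" and ac: "a > 0" "c > 0" "a * c = D + b\<^sup>2"
    and red: "2 * \<bar>b\<bar> \<le> a" "a \<le> c"
  shows "b = 0 \<and> (a = 1 \<or> a = 2 \<and> D mod 4 = 2)"
proof -
  have aa: "a\<^sup>2 \<le> D + b\<^sup>2"
    using mult_left_mono[OF red(2), of a] ac(1,3) by (simp add: power2_eq_square)
  have "(2 * \<bar>b\<bar>)\<^sup>2 \<le> a\<^sup>2" using red by (intro power_mono) auto
  then have "4 * b\<^sup>2 \<le> a\<^sup>2" by (simp add: power_mult_distrib)
  with aa have "3 * a\<^sup>2 \<le> 4 * D" by simp
  with D have "a\<^sup>2 < 9\<^sup>2" by (auto simp: genus_discs_def)
  then have "a < 9" using ac power2_less_imp_less[of a 9] by simp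
  define B where "B = \<bar>b\<bar>"
  have B: "B \<ge> 0" "2 * B \<le> a" "a * c = D + B\<^sup>2" using ac red by (auto simp: B_def)
  have "a = 1 \<or> a = 2 \<or> a = 3 \<or> a = 4 \<or> a = 5 \<or> a = 6 \<or> a = 7 \<or> a = 8"
    using ac \<open>a < 9\<close> by presburger
  moreover have "B = 0 \<or> B = 1 \<or> B = 2 \<or> B = 3 \<or> B = 4" using B \<open>a < 9\<close> by presburger
  moreover have "D = 1 \<or> D = 2 \<or> D = 6 \<or> D = 10 \<or> D = 22 \<or> D = 58"
    using D by (auto simp: genus_discs_def)
  ultimately have "B = 0 \<and> (a = 1 \<or> a = 2 \<and> D \<noteq> 1)"
    using B red(2) by (elim disjE; simp; presburger)
  then show ?thesis using D by (auto simp: B_def genus_discs_def)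
qed
text \<open>The form \<open>a X\<^sup>2 + 2 b X Y + c Y\<^sup>2\<close> or its double is obtained from \<open>U\<^sup>2 + D V\<^sup>2\<close> by the linear
  substitution \<open>U = e X + f Y\<close>, \<open>V = g X + h Y\<close>.\<close>

definition from_principal :: "int \<Rightarrow> int \<Rightarrow> int \<Rightarrow> int \<Rightarrow> bool" where
  "from_principal D a b c \<longleftrightarrow> (\<exists>s e f g h. (s = 1 \<or> s = 2 \<and> D mod 4 = 2) \<and>
    s * a = e\<^sup>2 + D * g\<^sup>2 \<and> s * b = e * f + D * g * h \<and> s * c = f\<^sup>2 + D * h\<^sup>2)"

lemma from_principalI:
  assumes "s = 1 \<or> s = 2 \<and> D mod 4 = 2" "s * a = e\<^sup>2 + D * g\<^sup>2"
    "s * b = e * f + D * g * h" "s * c = f\<^sup>2 + D * h\<^sup>2"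
  shows "from_principal D a b c"
  using assms unfolding from_principal_def by blast

lemma from_principal_swap:
  assumes "from_principal D c b a" shows "from_principal D a b c"
proof -
  from assms obtain s e f g h where "s = 1 \<or> s = 2 \<and> D mod 4 = 2"
      "s * c = e\<^sup>2 + D * g\<^sup>2" "s * b = e * f + D * g * h" "s * a = f\<^sup>2 + D * h\<^sup>2"
    unfolding from_principal_def by blast
  then show ?thesis by (intro from_principalI[of s D a f h b e g c]) (simp_all add: mult_ac)
qed

text \<open>The shift replaces \<open>X\<close> by \<open>X + j Y\<close>. It is undone by
  subtracting \<open>j\<close> times the column \<open>(e, g)\<close> from the column
  \<open>(f, h)\<close>.\<close>

lemma from_principal_shift:
  assumes "from_principal D a (b + j * a) (c + 2 * j * b + j\<^sup>2 * a)"
  shows "from_principal D a b c"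
proof -
  from assms obtain s e f g h where s: "s = 1 \<or> s = 2 \<and> D mod 4 = 2"
    and 1: "s * a = e\<^sup>2 + D * g\<^sup>2" and 2: "s * (b + j * a) = e * f + D * g * h"
    and 3: "s * (c + 2 * j * b + j\<^sup>2 * a) = f\<^sup>2 + D * h\<^sup>2"
    unfolding from_principal_def by blast
  have 4: "s * b = e * (f - j * e) + D * g * (h - j * g)"
  proof -
    have "s * b = s * (b + j * a) - j * (s * a)" by (simp add: algebra_simps)
    then show ?thesis unfolding 1 2 by (simp add: power2_eq_square algebra_simps)
  qed
  have 5: "s * c = (f - j * e)\<^sup>2 + D * (h - j * g)\<^sup>2"
  proof -
    have "s * c = s * (c + 2 * j * b + j\<^sup>2 * a) - 2 * j * (s * (b + j * a)) + j\<^sup>2 * (s * a)"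
      by (simp add: power2_eq_square algebra_simps)
    then show ?thesis unfolding 1 2 3 by (simp add: power2_eq_square algebra_simps)
  qed
  show ?thesis by (rule from_principalI[OF s 1 4 5])
qed

text \<open>Lagrange reduction: while \<open>2 \<bar>b\<bar>\<close> exceeds an outer coefficient, a
  shift (after a swap if necessary) makes \<open>\<bar>b\<bar>\<close> smaller; otherwise the form
  is reduced up to the order of \<open>a\<close> and \<open>c\<close>.\<close>

lemma form_reduction:
  fixes D a b c :: int
  assumes D: "D \<in> genus_discs" and "a > 0" "c > 0" "a * c = D + b\<^sup>2"
  shows "from_principal D a b c"
  using assms(2-)
proof (induction "nat \<bar>b\<bar>" arbitrary: a b c rule: less_induct)
  case less
  have step: "from_principal D a b c"
    if ac: "a > 0" "c > 0" "a * c = D + b\<^sup>2" and b: "a < 2 * \<bar>b\<bar>"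
      and IH: "\<And>b' a c. nat \<bar>b'\<bar> < nat \<bar>b\<bar> \<Longrightarrow> a > 0 \<Longrightarrow> c > 0 \<Longrightarrow> a * c = D + b'\<^sup>2 \<Longrightarrow>
        from_principal D a b' c"
    for a c
  proof -
    \<comment> \<open>One step towards 0 is enough: for positive \<open>a\<close>,
      \<open>\<bar>b - sgn b * a\<bar> < \<bar>b\<bar>\<close> as soon as
      \<open>a < 2 \<bar>b\<bar>\<close>.\<close>
    define j where "j = - sgn b"
    have "b \<noteq> 0" using b ac by auto
    then have lt: "nat \<bar>b + j * a\<bar> < nat \<bar>b\<bar>" using b ac by (auto simp: j_def sgn_if)
    have eq: "a * (c + 2 * j * b + j\<^sup>2 * a) = D + (b + j * a)\<^sup>2"
      using ac(3) by (simp add: power2_eq_square algebra_simps)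
    have "D > 0" using D by (auto simp: genus_discs_def)
    then have "0 < a * (c + 2 * j * b + j\<^sup>2 * a)"
      unfolding eq by (simp add: add_pos_nonneg)
    then have "c + 2 * j * b + j\<^sup>2 * a > 0" using ac by (simp add: zero_less_mult_iff)
    then show ?thesis by (intro from_principal_shift[of D a b j c] IH lt ac(1) eq)
  qed
  have base: "from_principal D a b c"
    if ac: "a > 0" "c > 0" "a * c = D + b\<^sup>2" and "2 * \<bar>b\<bar> \<le> a" "a \<le> c" for a c
  proof -
    have "b = 0" "a = 1 \<or> a = 2 \<and> D mod 4 = 2" using form_reduction_base[OF D that] by auto
    \<comment> \<open>The diagonal form \<open>a X^2 + c Y^2\<close> times \<open>s = a\<close> is
      \<open>(a X)^2 + D Y^2\<close>, hence \<open>e = a\<close>, \<open>h = 1\<close>,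
      \<open>f = g = 0\<close>.\<close>
    then show ?thesis using ac
      by (intro from_principalI[of a D a a 0 b 0 1 c]) (simp_all add: power2_eq_square)
  qed
  have ca: "c * a = D + b\<^sup>2" using less.prems by (simp add: mult.commute)
  consider "a < 2 * \<bar>b\<bar>" | "c < 2 * \<bar>b\<bar>" | "2 * \<bar>b\<bar> \<le> a" "a \<le> c" | "2 * \<bar>b\<bar> \<le> c" "c \<le> a"
    by linarith
  then show ?case
  proof cases
    case 1 show ?thesis by (rule step[OF less.prems 1]) (rule less.hyps)
  next
    case 2 show ?thesis
      by (rule from_principal_swap, rule step[OF less.prems(2,1) ca 2]) (rule less.hyps)
  next
    case 3 then show ?thesis by (rule base[OF less.prems])
  next
    case 4
    show ?thesis by (rule from_principal_swap, rule base[OF less.prems(2,1) ca 4])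
  qed
qed

text \<open>With \<open>p c = k^2 + D\<close>, the form \<open>p X^2 + 2 k X Y + c Y^2\<close> has
  determinant \<open>D\<close> and takes the value \<open>p\<close> at \<open>(1, 0)\<close>;
  reducing it yields the representation.\<close>

lemma split_prime_rep:
  fixes D p k :: int
  assumes D: "D \<in> genus_discs" and p: "prime p" and h: "p dvd k\<^sup>2 + D"
  obtains s u v where "u\<^sup>2 + D * v\<^sup>2 = s * p" "s = 1 \<or> s = 2 \<and> D mod 4 = 2"
proof -
  obtain c where c: "k\<^sup>2 + D = p * c" using h by (auto elim: dvdE)
  have "D > 0" using D by (auto simp: genus_discs_def)
  then have "0 < p * c" unfolding c[symmetric] by (simp add: add_nonneg_pos)
  moreover have "p > 0" using p prime_gt_0_int by auto
  ultimately have "c > 0" by (simp add: zero_less_mult_iff)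
  with \<open>p > 0\<close> c have "from_principal D p k c" by (intro form_reduction D) simp_all
  then obtain s e g where "s = 1 \<or> s = 2 \<and> D mod 4 = 2" "s * p = e\<^sup>2 + D * g\<^sup>2"
    unfolding from_principal_def by blast
  then show ?thesis by (intro that[of e g s]) simp_all
qed

text \<open>For \<open>s = 1\<close> the Hecke relation holds for each summand of
  \<open>nreps\<close> separately; for \<open>s = 2\<close> it exchanges the two summands. Their sum
  obeys the same recursion in both cases.\<close>

lemma nreps_split:
  fixes D p k M :: int
  assumes D: "D \<in> genus_discs" and p: "prime p" "odd p" "\<not> p dvd D" and h: "p dvd k\<^sup>2 + D"
  shows "nreps D (p * M) + (if p dvd M then nreps D (M div p) else 0) = 2 * nreps D M"
proof -
  obtain s u v where uv: "u\<^sup>2 + D * v\<^sup>2 = s * p" and s: "s = 1 \<or> s = 2 \<and> D mod 4 = 2"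
    by (rule split_prime_rep[OF D p(1) h])
  have D0: "D > 0" and D4: "D mod 4 \<in> {1, 2}" using D by (auto simp: genus_discs_def)
  note H = hecke_relation[OF D0 p uv s]
  have p0: "p > 0" using p prime_gt_0_int by auto
  have cut: "card {(x, y). p * (x\<^sup>2 + D * y\<^sup>2) = r * M} =
      (if p dvd M then card (reps D (r * (M div p))) else 0)" if "coprime p r" for r
  proof (cases "p dvd M")
    case True
    then obtain M' where M': "M = p * M'" by (auto elim: dvdE)
    have "p * (x\<^sup>2 + D * y\<^sup>2) = r * M \<longleftrightarrow> x\<^sup>2 + D * y\<^sup>2 = r * M'" for x y
      using p0 unfolding M' by (auto simp: mult.left_commute)
    then show ?thesis using True M' p0 by (simp add: reps_def)
  next
    case False
    have "p * (x\<^sup>2 + D * y\<^sup>2) \<noteq> r * M" for x y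
    proof
      assume "p * (x\<^sup>2 + D * y\<^sup>2) = r * M"
      then have "p dvd r * M" by (metis dvd_triv_left)
      with that False show False by (simp add: coprime_dvd_mult_right_iff)
    qed
    then show ?thesis using False by simp
  qed
  have c2: "coprime p 2" "coprime p 4"
    using p by (auto simp: coprime_right_2_iff_odd intro: coprime_power_right_iff[of p 2 2, THEN iffD2, simplified])
  from s show ?thesis
  proof
    assume [simp]: "s = 1"
    have "card (reps D (p * M)) + (if p dvd M then card (reps D (M div p)) else 0) = 2 * card (reps D M)"
      using H[of M] cut[of 1] by (simp split: if_splits)
    moreover have "card (reps D (2 * (p * M))) + (if p dvd M then card (reps D (2 * (M div p))) else 0)
        = 2 * card (reps D (2 * M))"
      using H[of "2 * M"] cut[of 2] c2 by (simp add: mult.left_commute split: if_splits)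
    ultimately show ?thesis by (simp add: nreps_def split: if_splits)
  next
    assume "s = 2 \<and> D mod 4 = 2"
    then have [simp]: "s = 2" by simp
    have "card (reps D (2 * (p * M))) + (if p dvd M then card (reps D (2 * (M div p))) else 0) = 2 * card (reps D M)"
      using H[of M] cut[of 2] c2 by (simp add: mult.assoc split: if_splits)
    \<comment> \<open>The relation at \<open>2 M\<close> involves \<open>4 p M\<close> and
      \<open>4 M / p\<close>; the factor 4 drops out of both counts.\<close>
    moreover have "card (reps D (p * M)) + (if p dvd M then card (reps D (M div p)) else 0)
        = 2 * card (reps D (2 * M))"
      using H[of "2 * M"] cut[of 4] c2 card_reps_four_mult[OF D4, of "p * M"]
        card_reps_four_mult[OF D4, of "M div p"] by (simp add: mult.left_commute split: if_splits)
    ultimately show ?thesis by (simp add: nreps_def split: if_splits)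
  qed
qed

text \<open>A sequence with \<open>r(j + 1) = 2 r(j) - r(j - 1)\<close> is an arithmetic
  progression, and \<open>r(1) = 2 r(0)\<close> because \<open>p\<close> does not divide
  \<open>M\<close>. The induction carries two consecutive terms.\<close>

lemma nreps_split_power:
  fixes D p k M :: int
  assumes D: "D \<in> genus_discs" and p: "prime p" "odd p" "\<not> p dvd D" and h: "p dvd k\<^sup>2 + D"
    and M: "\<not> p dvd M"
  shows "nreps D (p ^ j * M) = (j + 1) * nreps D M"
proof -
  have p0: "p \<noteq> 0" using p by auto
  have "nreps D (p ^ j * M) = (j + 1) * nreps D M \<and> nreps D (p ^ Suc j * M) = (j + 2) * nreps D M"
  proof (induction j)
    case 0
    show ?case using nreps_split[OF D p h, of M] M by simp
  next
    case (Suc j)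
    have "nreps D (p * (p ^ Suc j * M)) + nreps D (p ^ j * M) = 2 * nreps D (p ^ Suc j * M)"
      using nreps_split[OF D p h, of "p ^ Suc j * M"] p0 by (simp add: mult.assoc)
    then show ?case using Suc by (simp add: mult.assoc algebra_simps)
  qed
  then show ?thesis by simp
qed

section \<open>The prime 2, odd ramified primes and inert primes\<close>

lemma nreps_two_mult:
  assumes "D \<in> genus_discs"
  shows "nreps D (2 * M) = nreps D M"
  using card_reps_four_mult[of D M] assms by (auto simp: nreps_def genus_discs_def)

lemma card_reps_two_mult:
  fixes t :: int
  shows "card (reps (2 * t) (2 * K)) = card {(x, y). 2 * x\<^sup>2 + t * y\<^sup>2 = K}"
proof -
  have "reps (2 * t) (2 * K) = (\<lambda>(x, y). (2 * x, y)) ` {(x, y). 2 * x\<^sup>2 + t * y\<^sup>2 = K}"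
  proof (intro equalityI subsetI)
    fix z assume "z \<in> reps (2 * t) (2 * K)"
    moreover obtain X y where z: "z = (X, y)" by (cases z)
    ultimately have eq: "X\<^sup>2 + 2 * t * y\<^sup>2 = 2 * K" by simp
    have "even (X\<^sup>2 + 2 * t * y\<^sup>2)" unfolding eq by simp
    then have "even X" by simp
    then obtain x where x: "X = 2 * x" by (auto elim: evenE)
    have "2 * x\<^sup>2 + t * y\<^sup>2 = K" using eq unfolding x by (simp add: power_mult_distrib)
    then show "z \<in> (\<lambda>(x, y). (2 * x, y)) ` {(x, y). 2 * x\<^sup>2 + t * y\<^sup>2 = K}"
      unfolding z x by force
  qed (auto simp: power_mult_distrib)
  then show ?thesis by (simp add: card_image inj_on_def)
qed

text \<open>\<open>p\<close> divides the first coordinate, and cancelling \<open>p\<close> leaves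
  \<open>2 x^2 + p y^2 = K\<close>: a ramified prime exchanges the two forms.\<close>

lemma card_reps_ramified:
  fixes p :: int
  assumes p: "prime p" "odd p"
  shows "card (reps (2 * p) (p * K)) = card (reps (2 * p) (2 * K))"
proof -
  have p0: "p > 0" using p prime_gt_0_int by auto
  have "reps (2 * p) (p * K) = (\<lambda>(x, y). (p * y, x)) ` {(x, y). 2 * x\<^sup>2 + p * y\<^sup>2 = K}"
  proof (intro equalityI subsetI)
    fix z assume "z \<in> reps (2 * p) (p * K)"
    moreover obtain X x where z: "z = (X, x)" by (cases z)
    ultimately have eq: "X\<^sup>2 + 2 * p * x\<^sup>2 = p * K" by simp
    then have "X\<^sup>2 = p * (K - 2 * x\<^sup>2)" by (simp add: algebra_simps)
    then have "p dvd X\<^sup>2" by simp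
    then have "p dvd X" using p(1) by (rule prime_dvd_power[rotated])
    then obtain y where y: "X = p * y" by (auto elim: dvdE)
    have "p * (2 * x\<^sup>2 + p * y\<^sup>2) = p * K"
      using eq unfolding y by (simp add: power2_eq_square algebra_simps)
    then have "2 * x\<^sup>2 + p * y\<^sup>2 = K" using p0 by simp
    then show "z \<in> (\<lambda>(x, y). (p * y, x)) ` {(x, y). 2 * x\<^sup>2 + p * y\<^sup>2 = K}"
      unfolding z y by force
  qed (auto simp: power2_eq_square algebra_simps)
  then show ?thesis using p0 by (simp add: card_image inj_on_def card_reps_two_mult)
qed

text \<open>Multiplication by \<open>p\<close> swaps the two summands of \<open>nreps\<close>, as
  multiplication by 2 does, since factors 4 drop out.\<close>

lemma nreps_ramified:
  fixes p :: int
  assumes p: "prime p" "odd p"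
  shows "nreps (2 * p) (p * M) = nreps (2 * p) M"
proof -
  have "card (reps (2 * p) (4 * M)) = card (reps (2 * p) M)"
    using p(2) by (intro card_reps_four_mult) (auto elim!: oddE)
  then show ?thesis
    using card_reps_ramified[OF p, of M] card_reps_ramified[OF p, of "2 * M"]
    by (simp add: nreps_def mult.left_commute)
qed

lemma nreps_inert:
  fixes p :: int
  assumes p: "p > 0" and inert: "\<And>x y. p dvd x\<^sup>2 + D * y\<^sup>2 \<Longrightarrow> p dvd x \<and> p dvd y"
  shows "nreps D (p\<^sup>2 * M) = nreps D M"
proof -
  have "card (reps D (p\<^sup>2 * K)) = card (reps D K)" for K
    using inert by (intro card_reps_square_mult p) (metis dvd_power dvd_trans zero_less_numeral)
  from this[of M] this[of "2 * M"] show ?thesis by (simp add: nreps_def mult.left_commute)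
qed

section \<open>The multiplicative formula\<close>

text \<open>Extra primes in the index set add only factors 1, so products for different
  \<open>N\<close> can be compared over a common set.\<close>

lemma ndivisors_avoiding_eq:
  assumes "finite P" "\<And>p. p \<in> P \<Longrightarrow> prime p" "prime_factors N \<subseteq> P"
  shows "ndivisors_avoiding A N = (\<Prod>p\<in>P - A. 1 + multiplicity p N)"
  unfolding ndivisors_avoiding_def
proof (rule prod.mono_neutral_left)
  show "\<forall>p\<in>P - A - (prime_factors N - A). 1 + multiplicity p N = 1"
    using assms(2) by (auto simp: prime_factors_multiplicity)
qed (use assms in auto)

lemma ndivisors_avoiding_prime_power_mult:
  assumes p: "prime p" "\<not> p dvd M" and M: "M > 0"
  shows "ndivisors_avoiding A (p ^ k * M) = (if p \<in> A then 1 else 1 + k) * ndivisors_avoiding A M"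
proof -
  define P where "P = insert p (prime_factors M)"
  have P: "finite P" "\<And>q. q \<in> P \<Longrightarrow> prime q" using p by (auto simp: P_def)
  have "prime_factors (p ^ k * M) \<subseteq> P"
  proof
    fix q assume "q \<in> prime_factors (p ^ k * M)"
    then have "prime q" "q dvd p ^ k * M"
      by (blast intro: in_prime_factors_imp_prime in_prime_factors_imp_dvd)+
    then have q: "prime q" "q dvd p ^ k \<or> q dvd M" by (simp_all add: prime_dvd_mult_iff)
    from q(2) show "q \<in> P"
    proof
      assume "q dvd p ^ k"
      then have "q dvd p" using q(1) prime_dvd_power by blast
      then show ?thesis using primes_dvd_imp_eq[OF q(1) p(1)] by (simp add: P_def)
    qed (use q(1) M in \<open>simp add: P_def prime_factors_dvd\<close>)
  qed
  then have eq: "ndivisors_avoiding A (p ^ k * M) = (\<Prod>q\<in>P - A. 1 + multiplicity q (p ^ k * M))"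
    by (intro ndivisors_avoiding_eq P)
  have "multiplicity q (p ^ k * M) = (if q = p then k else multiplicity q M)" if "prime q" for q
    using that p M
    by (auto simp: prime_elem_multiplicity_mult_distrib prime_elem_multiplicity_power_distrib
        prime_multiplicity_other not_dvd_imp_multiplicity_0)
  then have "ndivisors_avoiding A (p ^ k * M) =
      (\<Prod>q\<in>P - A. 1 + (if q = p then k else multiplicity q M))"
    unfolding eq using P by (intro prod.cong) auto
  also have "\<dots> = (if p \<in> A then 1 else 1 + k) * (\<Prod>q\<in>P - A. 1 + multiplicity q M)"
  proof (cases "p \<in> A")
    case True
    then show ?thesis by (auto intro!: prod.cong)
  next
    case False
    have "multiplicity p M = 0" using p by (simp add: not_dvd_imp_multiplicity_0)
    then show ?thesis using False P
      by (subst (1 2) prod.remove[of "P - A" p]) (auto simp: P_def intro!: prod.cong)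
  qed
  also have "(\<Prod>q\<in>P - A. 1 + multiplicity q M) = ndivisors_avoiding A M"
    by (intro ndivisors_avoiding_eq[symmetric] P) (auto simp: P_def)
  finally show ?thesis .
qed

lemma ndivisors_prime_power_mult:
  assumes p: "prime p" "\<not> p dvd M" and M: "M > 0"
  shows "ndivisors (p ^ k * M) = (1 + k) * ndivisors M"
proof -
  have "{d. d dvd p ^ k * M} = (\<lambda>(j, d). p ^ j * d) ` ({..k} \<times> {d. d dvd M})"
  proof (intro equalityI subsetI)
    fix e assume "e \<in> {d. d dvd p ^ k * M}"
    then obtain b d where "e = b * d" "b dvd p ^ k" "d dvd M"
      using division_decomp[of e "p ^ k" M] by auto
    moreover from this obtain j where "j \<le> k" "b = p ^ j"
      using p(1) divides_primepow_nat by blast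
    ultimately show "e \<in> (\<lambda>(j, d). p ^ j * d) ` ({..k} \<times> {d. d dvd M})" by auto
  qed (auto intro!: mult_dvd_mono le_imp_power_dvd)
  moreover have "inj_on (\<lambda>(j, d). p ^ j * d) ({..k} \<times> {d. d dvd M})"
  proof (rule inj_onI, clarify)
    fix i j d e assume de: "d dvd M" "e dvd M" and eq: "p ^ i * d = p ^ j * e"
    have "d > 0" "e > 0" using de M by (simp_all add: dvd_pos_nat)
    moreover have "\<not> p dvd d" "\<not> p dvd e" using de p(2) by (meson dvd_trans)+
    ultimately have "multiplicity p (p ^ i * d) = i" "multiplicity p (p ^ j * e) = j"
      using p by (simp_all add: prime_elem_multiplicity_mult_distrib
          prime_elem_multiplicity_power_distrib not_dvd_imp_multiplicity_0)
    with eq have "i = j" by simp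
    with eq p show "i = j \<and> d = e" by simp
  qed
  ultimately show ?thesis by (simp add: ndivisors_def card_image card_cartesian_product)
qed

text \<open>Strips off the full power of one prime at a time, the natural induction for
  multiplicative functions.\<close>

lemma prime_power_induct [consumes 1, case_names one mult]:
  fixes N :: nat
  assumes "N > 0" and one: "P 1"
    and mult: "\<And>p k M. prime p \<Longrightarrow> \<not> p dvd M \<Longrightarrow> M > 0 \<Longrightarrow> k > 0 \<Longrightarrow> P M \<Longrightarrow> P (p ^ k * M)"
  shows "P N"
  using assms(1)
proof (induction N rule: less_induct)
  case (less N)
  show ?case
  proof (cases "N = 1")
    case False
    then obtain p where p: "prime p" "p dvd N" using prime_factor_nat by blast
    define k where "k = multiplicity p N"
    obtain M where N: "N = p ^ k * M" and M: "\<not> p dvd M"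
      using multiplicity_decompose'[of N p] p less.prems not_prime_unit[of p] unfolding k_def
      by blast
    have k: "k > 0" using p less.prems by (simp add: k_def prime_multiplicity_gt_zero_iff)
    have "M > 0" using N less.prems by (auto intro: Nat.gr0I)
    moreover have "1 < p ^ k" using one_less_power[OF prime_gt_1_nat[OF p(1)] k] .
    ultimately have "M < N" unfolding N by simp
    then have "P M" using \<open>M > 0\<close> by (rule less.IH)
    from mult[OF p(1) M \<open>M > 0\<close> k this] show ?thesis unfolding N[symmetric] .
  qed (use one in simp)
qed

lemma ndivisors_eq_avoiding:
  assumes "N > 0"
  shows "ndivisors N = ndivisors_avoiding {} N"
  using assms
proof (induction rule: prime_power_induct)
  case one
  show ?case by (simp add: ndivisors_def ndivisors_avoiding_def)
next
  case (mult p k M)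
  then show ?case by (simp add: ndivisors_prime_power_mult ndivisors_avoiding_prime_power_mult)
qed

text \<open>Anisotropy of the form modulo \<open>p\<close>; for prime \<open>p\<close> this says
  that \<open>-D\<close> is not a square modulo \<open>p\<close>.\<close>

definition inert :: "int \<Rightarrow> int \<Rightarrow> bool" where
  "inert D p \<longleftrightarrow> (\<forall>x y. p dvd x\<^sup>2 + D * y\<^sup>2 \<longrightarrow> p dvd x \<and> p dvd y)"

text \<open>\<open>A\<close> collects the ramified and inert primes; all other primes split.\<close>

definition separates :: "nat set \<Rightarrow> int \<Rightarrow> nat \<Rightarrow> bool" where
  "separates A D p \<longleftrightarrow> (if p \<in> A then p = 2 \<or> D = 2 * int p \<or> inert D (int p)
     else odd p \<and> \<not> int p dvd D \<and> (\<exists>k. int p dvd k\<^sup>2 + D))"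

text \<open>A representation of \<open>p K\<close> would have both coordinates divisible by
  \<open>p\<close>, so \<open>p^2\<close> would divide \<open>p K\<close>. Oddness of
  \<open>p\<close> carries this over to \<open>2 M\<close>.\<close>

lemma nreps_inert_zero:
  assumes p: "prime p" "odd p" and inert: "inert D p" and M: "\<not> p dvd M"
  shows "nreps D (p * M) = 0"
proof -
  have "reps D (p * K) = {}" if "\<not> p dvd K" for K
  proof (rule ccontr)
    assume "reps D (p * K) \<noteq> {}"
    then obtain x y where eq: "x\<^sup>2 + D * y\<^sup>2 = p * K" by (auto simp: reps_def)
    then have "p dvd x\<^sup>2 + D * y\<^sup>2" by simp
    then have "p dvd x" "p dvd y" using inert unfolding inert_def by blast+
    then have "p * p dvd x\<^sup>2 + D * y\<^sup>2" by (simp add: power2_eq_square mult_dvd_mono)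
    then have "p * p dvd p * K" unfolding eq .
    then show False using that p(1) by simp
  qed
  moreover have "\<not> p dvd 2"
    using p prime_ge_2_int[of p] zdvd_imp_le[of p 2] by (cases "p = 2") auto
  then have "\<not> p dvd 2 * M" using M p by (simp add: prime_dvd_mult_iff)
  ultimately show ?thesis using M by (simp add: nreps_def mult.left_commute)
qed

lemma nreps_prime_power_mult:
  assumes D: "D \<in> genus_discs" and p: "prime p" "\<not> p dvd M" and sep: "separates A D p"
    and nz: "nreps D (int (p ^ k * M)) \<noteq> 0"
  shows "nreps D (int (p ^ k * M)) = (if p \<in> A then 1 else 1 + k) * nreps D (int M)"
proof (cases "p \<in> A")
  case False
  with sep obtain h where "odd (int p)" "\<not> int p dvd D" "int p dvd h\<^sup>2 + D"
    by (auto simp: separates_def)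
  with p D False nreps_split_power[of D "int p" h "int M" k] show ?thesis by simp
next
  case True
  then consider "p = 2" | "p \<noteq> 2" "D = 2 * int p" | "p \<noteq> 2" "inert D (int p)"
    using sep by (auto simp: separates_def)
  then have "nreps D (int p ^ k * int M) = nreps D (int M)"
  proof cases
    case 1
    show ?thesis unfolding 1 by (induction k) (simp_all add: nreps_two_mult[OF D] mult.assoc)
  next
    case 2
    then have "odd p" using primes_dvd_imp_eq[OF two_is_prime_nat p(1)] by auto
    with p have "nreps (2 * int p) (int p * K) = nreps (2 * int p) K" for K
      by (intro nreps_ramified) simp_all
    then show ?thesis unfolding 2(2) by (induction k) (simp_all add: mult.assoc)
  next
    case 3
    then have "odd p" using primes_dvd_imp_eq[OF two_is_prime_nat p(1)] by auto
    have p0: "int p > 0" using p prime_gt_0_nat by simp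
    have in2: "int p dvd x \<and> int p dvd y" if "int p dvd x\<^sup>2 + D * y\<^sup>2" for x y
      using 3(2) that unfolding inert_def by blast
    have sq: "nreps D ((int p)\<^sup>2 ^ j * K) = nreps D K" for j K
      by (induction j) (simp_all add: nreps_inert[OF p0 in2] mult.assoc)
    show ?thesis
    proof (cases "even k")
      case True
      then obtain j where "k = 2 * j" by (auto elim: evenE)
      then show ?thesis using sq[of j] by (simp add: power_mult)
    next
      case False
      then obtain j where "k = 2 * j + 1" by (auto elim: oddE)
      \<comment> \<open>An odd power of an inert prime leaves a single factor \<open>p\<close> and
        hence no representations, contrary to \<open>nz\<close>.\<close>
      then have "nreps D (int (p ^ k * M)) = nreps D (int p * int M)"
        using sq[of j "int p * int M"] by (simp add: power_mult mult.left_commute mult.assoc)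
      also have "\<dots> = 0" using p \<open>odd p\<close> 3(2) by (intro nreps_inert_zero) simp_all
      finally show ?thesis using nz by simp
    qed
  qed
  then show ?thesis using True by simp
qed

text \<open>The local factor shows that nonvanishing passes from \<open>p^k M\<close> to
  \<open>M\<close>, so the induction hypothesis applies.\<close>

theorem nreps_eq:
  assumes D: "D \<in> genus_discs" and "N > 0"
    and "\<And>p. p \<in> prime_factors N \<Longrightarrow> separates A D p" and "nreps D (int N) \<noteq> 0"
  shows "nreps D (int N) = nreps D 1 * ndivisors_avoiding A N"
  using assms(2-)
proof (induction rule: prime_power_induct)
  case one
  show ?case by (simp add: ndivisors_avoiding_def)
next
  case (mult p k M)
  have "p \<in> prime_factors (p ^ k * M)" using mult.hyps by (auto simp: prime_factors_dvd)
  then have "separates A D p" using mult.prems by blast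
  then have eq: "nreps D (int (p ^ k * M)) = (if p \<in> A then 1 else 1 + k) * nreps D (int M)"
    using D mult.hyps mult.prems by (intro nreps_prime_power_mult)
  have "nreps D (int M) = nreps D 1 * ndivisors_avoiding A M"
    using mult.prems eq mult.hyps by (intro mult.IH) (auto simp: prime_factors_dvd)
  then show ?case unfolding eq using mult.hyps by (simp add: ndivisors_avoiding_prime_power_mult)
qed

section \<open>Polygonal numbers and points on a conic\<close>

lemma polygonal_square:
  "8 * (int m - 2) * polygonal m c + (int m - 4)\<^sup>2 = (2 * (int m - 2) * c - (int m - 4))\<^sup>2"
proof -
  have "c * ((int m - 2) * c - (int m - 4)) = (int m - 2) * (c * (c - 1)) + 2 * c"
    by (simp add: algebra_simps)
  then have "even (c * ((int m - 2) * c - (int m - 4)))" by simp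
  then have "2 * polygonal m c = c * ((int m - 2) * c - (int m - 4))"
    unfolding polygonal_def by simp
  moreover have "8 * (int m - 2) * polygonal m c = 4 * (int m - 2) * (2 * polygonal m c)" by simp
  ultimately have "8 * (int m - 2) * polygonal m c = 4 * (int m - 2) * (c * ((int m - 2) * c - (int m - 4)))"
    by simp
  then show ?thesis by (simp add: power2_eq_square algebra_simps)
qed

text \<open>By completing the square, this says that polygonal numbers are nonnegative at all
  integers. It confines conic points to \<open>\<bar>x\<bar> <= n\<close>.\<close>

lemma abs_shifted_multiple_ge:
  fixes m c :: int
  assumes "m \<ge> 3"
  shows "\<bar>m - 4\<bar> \<le> \<bar>2 * (m - 2) * c - (m - 4)\<bar>"
proof -
  define k where "k = (m - 2) * c"
  have k: "2 * (m - 2) * c = 2 * k" by (simp add: k_def)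
  consider "c = 0" | "c \<ge> 1" | "c \<le> -1" by linarith
  then show ?thesis
  proof cases
    case 2
    then have "(m - 2) * 1 \<le> (m - 2) * c" using assms by (intro mult_left_mono) auto
    then show ?thesis using assms unfolding k k_def[symmetric] by (simp add: abs_if)
  next
    case 3
    then have "(m - 2) * c \<le> (m - 2) * (-1)" using assms by (intro mult_left_mono) auto
    then show ?thesis using assms unfolding k k_def[symmetric] by (simp add: abs_if)
  qed simp
qed

section \<open>Counting points by their sign symmetries\<close>

lemma card_symmetric_second:
  fixes E :: "(int \<times> int) set"
  assumes "finite E" and sym: "\<And>x y. (x, y) \<in> E \<Longrightarrow> (x, -y) \<in> E"
    and inj: "\<And>x y z. (x, y) \<in> E \<Longrightarrow> (x, z) \<in> E \<Longrightarrow> y\<^sup>2 = z\<^sup>2"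
    and nz: "\<And>x. (x, 0) \<notin> E"
  shows "card E = 2 * card (fst ` E)"
proof -
  define P where "P = {(x, y). (x, y) \<in> E \<and> y > 0}"
  define Q where "Q = (\<lambda>(x, y). (x, -y)) ` P"
  have "E = P \<union> Q"
  proof (intro equalityI subsetI)
    fix z assume z: "z \<in> E"
    obtain x y where xy: "z = (x, y)" by (cases z)
    have "y \<noteq> 0" using nz z xy by auto
    then consider "y > 0" | "y < 0" by linarith
    then show "z \<in> P \<union> Q"
    proof cases
      case 2
      then have "(x, -y) \<in> P" using sym z xy by (simp add: P_def)
      then show ?thesis unfolding xy Q_def by force
    qed (use z xy in \<open>simp add: P_def\<close>)
  qed (use sym in \<open>auto simp: P_def Q_def\<close>)
  moreover have "P \<inter> Q = {}" by (auto simp: P_def Q_def)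
  moreover have "card Q = card P" unfolding Q_def by (intro card_image) (auto intro!: inj_onI)
  moreover have "finite P" by (rule finite_subset[OF _ assms(1)]) (auto simp: P_def)
  ultimately have "card E = 2 * card P" by (simp add: card_Un_disjoint Q_def)
  moreover have "fst ` P = fst ` E"
  proof (intro equalityI subsetI)
    fix x assume "x \<in> fst ` E"
    then obtain y where y: "(x, y) \<in> E" by auto
    then have "y \<noteq> 0" using nz by auto
    then have "(x, \<bar>y\<bar>) \<in> P" using y sym[OF y] by (simp add: P_def abs_if)
    then show "x \<in> fst ` P" by force
  qed (auto simp: P_def)
  moreover have "inj_on fst P"
  proof (rule inj_onI, clarsimp simp: P_def)
    fix x y z assume "(x, y) \<in> E" "(x, z) \<in> E" "y > 0" "z > 0"
    then show "y = z" using inj[of x y z] by (simp add: power2_eq_iff)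
  qed
  ultimately show ?thesis by (metis card_image)
qed

text \<open>The endpoints \<open>n\<close> and \<open>-n\<close> contribute 2, elements strictly
  between 0 and \<open>n\<close> count twice, and the conditional term makes 0 count twice as
  well.\<close>

lemma card_symmetric_int:
  fixes X :: "int set"
  assumes "n > 0" "n \<in> X" and sym: "\<And>x. x \<in> X \<Longrightarrow> -x \<in> X" and bound: "\<And>x. x \<in> X \<Longrightarrow> x \<le> n"
  shows "card X + (if 0 \<in> X then 1 else 0) = 2 * card {x \<in> X. 0 \<le> x \<and> x < n} + 2"
proof -
  define P where "P = {x \<in> X. 0 < x \<and> x < n}"
  have "finite P" by (rule finite_subset[of _ "{0<..<n}"]) (auto simp: P_def)
  have "X = P \<union> uminus ` P \<union> {n, -n} \<union> ({0} \<inter> X)"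
  proof (intro equalityI subsetI)
    fix x assume x: "x \<in> X"
    then have "x \<le> n" "-x \<le> n" using sym bound by blast+
    then consider "x \<in> P" | "-x \<in> P" | "x = n" | "x = -n" | "x = 0"
      using x sym by (force simp: P_def)
    then show "x \<in> P \<union> uminus ` P \<union> {n, -n} \<union> ({0} \<inter> X)"
      using x by cases force+
  qed (use assms in \<open>auto simp: P_def\<close>)
  also have "card \<dots> = card (P \<union> uminus ` P \<union> {n, -n}) + card ({0} \<inter> X)"
    using \<open>finite P\<close> \<open>n > 0\<close> by (intro card_Un_disjoint) (auto simp: P_def)
  also have "card (P \<union> uminus ` P \<union> {n, -n}) = card (P \<union> uminus ` P) + card {n, -n}"
    using \<open>finite P\<close> by (intro card_Un_disjoint) (auto simp: P_def)
  also have "card (P \<union> uminus ` P) = card P + card (uminus ` P)"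
    using \<open>finite P\<close> by (intro card_Un_disjoint) (auto simp: P_def)
  also have "card (uminus ` P) = card P" by (simp add: card_image)
  also have "card {n, -n} = 2" using \<open>n > 0\<close> by simp
  also have "card ({0} \<inter> X) = (if 0 \<in> X then 1 else 0)" by simp
  finally have "card X = 2 * card P + 2 + (if 0 \<in> X then 1 else 0)" by simp
  moreover have "{x \<in> X. 0 \<le> x \<and> x < n} = P \<union> ({0} \<inter> X)" using \<open>n > 0\<close> by (auto simp: P_def)
  then have "card {x \<in> X. 0 \<le> x \<and> x < n} = card P + (if 0 \<in> X then 1 else 0)"
    using \<open>finite P\<close> by (simp add: card_Un_disjoint P_def)
  ultimately show ?thesis by auto
qed

text \<open>With \<open>x = a - b\<close> and \<open>y = 2 (m - 2) c - (m - 4)\<close>, the equation \<open>a b = t P(m, c)\<close> for \<open>a + b = n\<close>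
  becomes the equation of this conic.\<close>

definition conic_points :: "nat \<Rightarrow> nat \<Rightarrow> nat \<Rightarrow> (int \<times> int) set" where
  "conic_points m t n = {(x, y). 2 * (int m - 2) * x\<^sup>2 + int t * y\<^sup>2 =
     2 * (int m - 2) * (int n)\<^sup>2 + int t * (int m - 4)\<^sup>2 \<and> even (x - int n)}"

lemma rep_eq_iff:
  assumes "m \<ge> 3" "x = int a - int b" "a + b = n"
  shows "int (a * b) = int t * polygonal m c \<longleftrightarrow> (x, 2 * (int m - 2) * c - (int m - 4)) \<in> conic_points m t n"
proof -
  let ?y = "2 * (int m - 2) * c - (int m - 4)"
  have n: "int n = int a + int b" using assms by simp
  have x: "(int n)\<^sup>2 = x\<^sup>2 + 4 * int (a * b)" unfolding n assms by (simp add: power2_eq_square algebra_simps)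
  have "2 * (int m - 2) * (int n)\<^sup>2 + int t * (int m - 4)\<^sup>2 - (2 * (int m - 2) * x\<^sup>2 + int t * ?y\<^sup>2)
      = 8 * (int m - 2) * (int (a * b) - int t * polygonal m c)"
    unfolding x polygonal_square[symmetric] by (simp add: algebra_simps)
  moreover have "even (x - int n)" unfolding n assms by simp
  ultimately have "(x, ?y) \<in> conic_points m t n \<longleftrightarrow> 8 * (int m - 2) * (int (a * b) - int t * polygonal m c) = 0"
    unfolding conic_points_def by auto
  also have "\<dots> \<longleftrightarrow> int (a * b) = int t * polygonal m c" using assms(1) by auto
  finally show ?thesis by simp
qed

text \<open>Pairs correspond to \<open>x = a - b\<close> with \<open>0 <= x < n\<close>, as
  \<open>b > 0\<close> excludes \<open>x = n\<close>. By \<open>H\<close> only the sign of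
  \<open>y\<close> may need changing, and \<open>m \<noteq> 4\<close> keeps \<open>y\<close> away
  from 0, so every \<open>x\<close> has exactly two \<open>y\<close>.\<close>

lemma card_conic_points:
  assumes m: "m \<ge> 3" "m \<noteq> 4" and t: "t > 0" and n: "n > 0"
    and H: "\<And>x y. (x, y) \<in> conic_points m t n \<Longrightarrow>
      \<exists>c. y = 2 * (int m - 2) * c - (int m - 4) \<or> - y = 2 * (int m - 2) * c - (int m - 4)"
  shows "card (conic_points m t n) = 2 * card (fst ` conic_points m t n)"
    and "card (fst ` conic_points m t n) + (if 0 \<in> fst ` conic_points m t n then 1 else 0) =
      2 * rep_count m t n + 2"
proof -
  let ?E = "conic_points m t n" let ?X = "fst ` ?E"
  have y_ge: "(int m - 4)\<^sup>2 \<le> y\<^sup>2" if xy: "(x, y) \<in> ?E" for x y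
  proof -
    obtain c where "\<bar>y\<bar> = \<bar>2 * (int m - 2) * c - (int m - 4)\<bar>" using H[OF xy] by (metis abs_minus_cancel)
    with abs_shifted_multiple_ge[of "int m" c] m have "\<bar>int m - 4\<bar> \<le> \<bar>y\<bar>" by simp
    then show ?thesis by (simp add: abs_le_square_iff)
  qed
  have x_le: "x\<^sup>2 \<le> (int n)\<^sup>2" if xy: "(x, y) \<in> ?E" for x y
  proof -
    have "int t * (int m - 4)\<^sup>2 \<le> int t * y\<^sup>2" using y_ge[OF xy] by (intro mult_left_mono) auto
    with xy have "2 * (int m - 2) * x\<^sup>2 \<le> 2 * (int m - 2) * (int n)\<^sup>2" by (simp add: conic_points_def)
    then show ?thesis using m(1) by simp
  qed
  have y_pos: "(x, 0) \<notin> ?E" for x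
    using y_ge[of x 0] m by auto
  have sq: "y\<^sup>2 = z\<^sup>2" if "(x, y) \<in> ?E" "(x, z) \<in> ?E" for x y z
  proof -
    define K where "K = 2 * (int m - 2) * x\<^sup>2"
    have "K + int t * y\<^sup>2 = K + int t * z\<^sup>2" using that unfolding K_def conic_points_def by simp
    then show ?thesis using t by simp
  qed
  have sym: "(x, y) \<in> ?E \<Longrightarrow> (x, -y) \<in> ?E" "(x, y) \<in> ?E \<Longrightarrow> (-x, y) \<in> ?E" for x y
    by (simp_all add: conic_points_def)
  have X: "?X \<subseteq> {- int n..int n}"
  proof
    fix x assume "x \<in> ?X"
    then have "x\<^sup>2 \<le> (int n)\<^sup>2" using x_le by auto
    then have "\<bar>x\<bar> \<le> int n" using abs_le_square_iff[of x "int n"] by simp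
    then show "x \<in> {- int n..int n}" by auto
  qed
  have "finite ?E"
  proof (rule finite_subset)
    define K where "K = int t * (int m - 4)\<^sup>2 + 2 * (int m - 2) * (int n)\<^sup>2"
    show "?E \<subseteq> {- int n..int n} \<times> {-K..K}"
    proof clarify
      fix x y assume xy: "(x, y) \<in> ?E"
      have "y\<^sup>2 \<le> int t * y\<^sup>2" using t by (simp add: mult_le_cancel_right1)
      also have "\<dots> \<le> K"
      proof -
        have "0 \<le> 2 * (int m - 2) * x\<^sup>2" using m(1) by simp
        moreover have "2 * (int m - 2) * x\<^sup>2 + int t * y\<^sup>2 = K"
          using xy unfolding conic_points_def K_def by simp
        ultimately show ?thesis by linarith
      qed
      finally have "\<bar>y\<bar> \<le> K" using abs_le_square_int[of y] by simp
      moreover have "x \<in> ?X" using xy by force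
      ultimately show "x \<in> {- int n..int n} \<and> y \<in> {-K..K}" using X by auto
    qed
  qed simp
  then show "card ?E = 2 * card ?X" by (intro card_symmetric_second sym(1) sq y_pos)

  define X0 where "X0 = {x \<in> ?X. 0 \<le> x \<and> x < int n}"
  define R where "R = {(a, b). a > 0 \<and> b > 0 \<and> a \<ge> b \<and> a + b = n \<and>
     (\<exists>c. admissible m c \<and> int (a * b) = int t * polygonal m c)}"
  have "bij_betw (\<lambda>(a, b). int a - int b) R X0"
    unfolding bij_betw_def
  proof (intro conjI equalityI subsetI)
    show "inj_on (\<lambda>(a, b). int a - int b) R" by (auto simp: R_def inj_on_def)
  next
    fix x assume "x \<in> (\<lambda>(a, b). int a - int b) ` R"
    then obtain a b c where ab: "x = int a - int b" "b > 0" "a \<ge> b" "a + b = n"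
      and c: "int (a * b) = int t * polygonal m c" unfolding R_def by auto
    then have "(x, 2 * (int m - 2) * c - (int m - 4)) \<in> ?E" using rep_eq_iff[OF m(1) ab(1,4)] by blast
    then have "x \<in> ?X" by force
    then show "x \<in> X0" using ab by (simp add: X0_def)
  next
    fix x assume "x \<in> X0"
    then obtain y where xy: "(x, y) \<in> ?E" and x: "0 \<le> x" "x < int n" by (auto simp: X0_def)
    have "even (x - int n)" using xy by (simp add: conic_points_def)
    then obtain k where k: "x - int n = 2 * k" by (rule evenE)
    define a b where "a = nat (int n + k)" and "b = nat (- k)"
    have ab: "x = int a - int b" "b > 0" "a > 0" "a \<ge> b" "a + b = n" using k x by (auto simp: a_def b_def)
    obtain c where c: "(x, 2 * (int m - 2) * c - (int m - 4)) \<in> ?E" using H[OF xy] sym(1)[OF xy] xy by metis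
    \<comment> \<open>For \<open>m = 3\<close> the arguments \<open>c\<close> and
      \<open>- c - 1\<close> give opposite \<open>y\<close>. One of them is positive, because
      argument 0 would force \<open>x^2 = n^2\<close>.\<close>
    have "\<exists>c. admissible m c \<and> (x, 2 * (int m - 2) * c - (int m - 4)) \<in> ?E"
    proof (cases "m = 3")
      case False
      then show ?thesis using c m by (auto simp: admissible_def)
    next
      case True
      have ne: "c' \<noteq> 0" if "(x, 2 * c' + 1) \<in> ?E" for c'
      proof
        assume "c' = 0"
        with that True have "x\<^sup>2 = (int n)\<^sup>2" by (simp add: conic_points_def)
        with x show False by (simp add: power2_eq_iff)
      qed
      have c3: "(x, 2 * c + 1) \<in> ?E" using c True by simp
      have "- (2 * c + 1) = 2 * (- c - 1) + 1" by simp
      then have c3': "(x, 2 * (- c - 1) + 1) \<in> ?E" using sym(1)[OF c3] by (simp only:)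
      have "c > 0 \<or> - c - 1 > 0" using ne[OF c3] ne[OF c3'] by linarith
      then show ?thesis
      proof
        assume "c > 0" then show ?thesis using c3 True by (intro exI[of _ c]) (simp add: admissible_def)
      next
        assume "- c - 1 > 0"
        then show ?thesis using c3' True by (intro exI[of _ "- c - 1"]) (simp add: admissible_def)
      qed
    qed
    then have "(a, b) \<in> R" using ab rep_eq_iff[OF m(1) ab(1,5)] unfolding R_def by blast
    then show "x \<in> (\<lambda>(a, b). int a - int b) ` R" using ab(1) by force
  qed
  then have "rep_count m t n = card X0"
    unfolding rep_count_def R_def by (rule bij_betw_same_card)
  \<comment> \<open>The trivial point, which is \<open>c = 0\<close> up to the sign of
    \<open>y\<close>, supplies the endpoint \<open>x = n\<close>.\<close>
  moreover have "(int n, int m - 4) \<in> ?E" by (simp add: conic_points_def)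
  then have "int n \<in> ?X" by force
  then have "card ?X + (if 0 \<in> ?X then 1 else 0) = 2 * card X0 + 2"
    unfolding X0_def using n X sym(2) by (intro card_symmetric_int) force+
  ultimately show "card ?X + (if 0 \<in> ?X then 1 else 0) = 2 * rep_count m t n + 2" by simp
qed

text \<open>With \<open>r\<close> the number of pairs, \<open>d\<close> is \<open>2 r + 2\<close>
  or, if \<open>x = 0\<close> occurs, \<open>2 r + 1\<close>; the floor absorbs the
  difference.\<close>

lemma rep_count_eq_floor:
  assumes "m \<ge> 3" "m \<noteq> 4" "t > 0" "n > 0"
    and "\<And>x y. (x, y) \<in> conic_points m t n \<Longrightarrow>
      \<exists>c. y = 2 * (int m - 2) * c - (int m - 4) \<or> - y = 2 * (int m - 2) * c - (int m - 4)"
    and "card (conic_points m t n) = 2 * d"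
  shows "int (rep_count m t n) = \<lfloor>(real d - 1) / 2\<rfloor>"
proof -
  have d: "d + (if 0 \<in> fst ` conic_points m t n then 1 else 0) = 2 * rep_count m t n + 2"
    using card_conic_points[OF assms(1-5)] assms(6) by simp
  have "real (rep_count m t n) \<le> (real d - 1) / 2" "(real d - 1) / 2 < real (rep_count m t n) + 1"
    using d by (auto simp: field_simps split: if_splits)
  then show ?thesis by linarith
qed

section \<open>Separating the two genera\<close>

text \<open>If \<open>x\<close> were invertible modulo \<open>q\<close>, then \<open>y / x\<close>
  would be a square root of \<open>a\<close>. The nonresidue condition ranges over a list so that it
  can be checked by evaluation.\<close>

lemma dvd_sum_squares_nonresidue:
  fixes q a x y :: int
  assumes q: "prime q" and nonres: "\<forall>z\<in>set [0..q - 1]. (z\<^sup>2 - a) mod q \<noteq> 0"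
    and dvd: "q dvd y\<^sup>2 - a * x\<^sup>2"
  shows "q dvd x \<and> q dvd y"
proof -
  have "q dvd x"
  proof (rule ccontr)
    assume "\<not> q dvd x"
    then have "coprime x q" using q prime_imp_coprime coprime_commute by blast
    then obtain w where "[x * w = 1] (mod q)" using cong_solve_coprime_int by blast
    then have w: "q dvd x * w - 1" by (simp add: cong_iff_dvd_diff)
    have "q dvd (y\<^sup>2 - a * x\<^sup>2) * w\<^sup>2 + a * (x * w + 1) * (x * w - 1)"
      by (rule dvd_add[OF dvd_mult2[OF dvd] dvd_mult[OF w]])
    also have "(y\<^sup>2 - a * x\<^sup>2) * w\<^sup>2 + a * (x * w + 1) * (x * w - 1) = (y * w)\<^sup>2 - a"
      by (simp add: power2_eq_square algebra_simps)
    finally have "((y * w)\<^sup>2 - a) mod q = 0" by (simp add: dvd_eq_mod_eq_0)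
    then have "(((y * w) mod q)\<^sup>2 - a) mod q = 0" by (metis mod_diff_left_eq power_mod)
    moreover have "(y * w) mod q \<in> set [0..q - 1]" using q prime_gt_0_int by simp
    with nonres have "(((y * w) mod q)\<^sup>2 - a) mod q \<noteq> 0" by (rule bspec)
    ultimately show False by contradiction
  qed
  then have "q dvd a * x\<^sup>2" by (simp add: power2_eq_square)
  then have "q dvd y\<^sup>2" using dvd by (simp add: dvd_diff_left_iff)
  then have "q dvd y" using q prime_dvd_power by blast
  with \<open>q dvd x\<close> show ?thesis by simp
qed

lemma inert_nonresidue:
  fixes p :: int
  assumes "prime p" "\<forall>z\<in>set [0..p - 1]. (z\<^sup>2 + D) mod p \<noteq> 0"
  shows "inert D p"
  unfolding inert_def
proof clarify
  fix x y assume "p dvd x\<^sup>2 + D * y\<^sup>2"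
  then show "p dvd x \<and> p dvd y" using dvd_sum_squares_nonresidue[of p "-D" x y] assms by auto
qed

text \<open>These are the pairs \<open>2 q\<close>, \<open>p\<close> with \<open>q\<close> one of 3,
  5, 11, 29 and \<open>p\<close> an odd prime factor of \<open>q - 2\<close> or
  \<open>2 q - 2\<close>, where the trivial representation does not exhibit \<open>-2 q\<close> as a
  square.\<close>

lemma inert_cases: "inert 10 3" "inert 22 3" "inert 58 3" "inert 22 5" "inert 58 7"
proof -
  have "prime (3 :: int)" "prime (5 :: int)" "prime (7 :: int)" by simp_all
  then show "inert 10 3" "inert 22 3" "inert 58 3" "inert 22 5" "inert 58 7"
    by (intro inert_nonresidue; simp add: upto.simps del: set_upto)+
qed

text \<open>Infinite descent: the two equations give \<open>q dvd z^2 - 2 x^2\<close>, so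
  \<open>q\<close> divides \<open>x\<close> and \<open>z\<close> because 2 is a nonresidue; after
  cancelling, the same holds for \<open>y\<close> and \<open>w\<close>, and \<open>N / q^2\<close>
  is a smaller example.\<close>

lemma reps_exclusive:
  fixes q :: int
  assumes q: "prime q" "odd q" and nonres: "\<forall>z\<in>set [0..q - 1]. (z\<^sup>2 - 2) mod q \<noteq> 0"
    and "N > 0" "reps (2 * q) (int N) \<noteq> {}"
  shows "reps (2 * q) (2 * int N) = {}"
proof (rule ccontr)
  assume "reps (2 * q) (2 * int N) \<noteq> {}"
  with assms(4,5) show False
  proof (induction N rule: less_induct)
    case (less N)
    have q0: "q > 1" using q prime_gt_1_int by simp
    note div = dvd_sum_squares_nonresidue[OF q(1) nonres]
    from less.prems obtain x y z w where xy: "x\<^sup>2 + 2 * q * y\<^sup>2 = int N"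
      and zw: "z\<^sup>2 + 2 * q * w\<^sup>2 = 2 * int N" by (auto simp: reps_def)
    have "z\<^sup>2 - 2 * x\<^sup>2 = q * (4 * y\<^sup>2 - 2 * w\<^sup>2)"
      using xy zw by (simp add: algebra_simps)
    then have "q dvd x" "q dvd z" using div[of z x] by simp_all
    then obtain x' z' where x': "x = q * x'" and z': "z = q * z'" by (auto elim!: dvdE)
    have "q * (2 * (q * x'\<^sup>2 + 2 * y\<^sup>2)) = q * (q * z'\<^sup>2 + 2 * w\<^sup>2)"
      using xy zw unfolding x' z' by (simp add: power2_eq_square algebra_simps)
    then have "2 * (q * x'\<^sup>2 + 2 * y\<^sup>2) = q * z'\<^sup>2 + 2 * w\<^sup>2" using q0 by simp
    then have "2 * (w\<^sup>2 - 2 * y\<^sup>2) = q * (2 * x'\<^sup>2 - z'\<^sup>2)" by (simp add: algebra_simps)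
    then have "q dvd 2 * (w\<^sup>2 - 2 * y\<^sup>2)" by simp
    moreover have "coprime q 2" using q by (simp add: coprime_right_2_iff_odd)
    ultimately have "q dvd w\<^sup>2 - 2 * y\<^sup>2" by (metis coprime_dvd_mult_right_iff)
    then have "q dvd y" "q dvd w" using div[of w y] by simp_all
    then obtain y' w' where y': "y = q * y'" and w': "w = q * w'" by (auto elim!: dvdE)
    define K where "K = x'\<^sup>2 + 2 * q * y'\<^sup>2"
    have N: "int N = q\<^sup>2 * K"
      unfolding xy[symmetric] x' y' K_def by (simp add: power2_eq_square algebra_simps)
    have "q\<^sup>2 * (z'\<^sup>2 + 2 * q * w'\<^sup>2) = 2 * int N"
      unfolding zw[symmetric] z' w' by (simp add: power2_eq_square algebra_simps)
    also have "\<dots> = q\<^sup>2 * (2 * K)" unfolding N by simp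
    finally have K2: "z'\<^sup>2 + 2 * q * w'\<^sup>2 = 2 * K" using q0 by simp
    have "K > 0" using zero_less_mult_pos[of "q\<^sup>2" K] N less.prems(1) q0 by simp
    have "1 < q\<^sup>2" using q0 by (simp add: one_less_power)
    then have "K < int N" unfolding N using \<open>K > 0\<close> by simp
    have nK: "int (nat K) = K" using \<open>K > 0\<close> by simp
    have "(x', y') \<in> reps (2 * q) (int (nat K))" "(z', w') \<in> reps (2 * q) (2 * int (nat K))"
      unfolding nK using K2 by (simp_all add: K_def)
    then have "reps (2 * q) (int (nat K)) \<noteq> {}" "reps (2 * q) (2 * int (nat K)) \<noteq> {}" by blast+
    moreover have "nat K < N" "nat K > 0" using \<open>K > 0\<close> \<open>K < int N\<close> by simp_all
    ultimately show False using less.IH[of "nat K"] by blast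
  qed
qed

lemma nreps_one:
  assumes "D > 2" shows "nreps D 1 = 2"
proof -
  have *: "y = 0" if "x\<^sup>2 + D * y\<^sup>2 \<le> 2" for x y
  proof (rule ccontr)
    assume "y \<noteq> 0"
    then have "D * 1 \<le> D * y\<^sup>2" using assms by (intro mult_left_mono) (auto simp: int_one_le_iff_zero_less)
    then show False using that assms zero_le_power2[of x] by linarith
  qed
  have "x\<^sup>2 + D * y\<^sup>2 = 1 \<longleftrightarrow> y = 0 \<and> (x = 1 \<or> x = -1)" for x y
  proof
    assume xy: "x\<^sup>2 + D * y\<^sup>2 = 1"
    then have "y = 0" by (intro *[of x y]) simp
    with xy show "y = 0 \<and> (x = 1 \<or> x = -1)" by (simp add: power2_eq_1_iff)
  qed auto
  then have "reps D 1 = {(1, 0), (-1, 0)}" by (auto simp: reps_def)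
  moreover have sq2: "x\<^sup>2 \<noteq> 2" for x :: int
  proof
    assume x: "x\<^sup>2 = 2"
    then have "even x" by (metis even_numeral even_power)
    then obtain w where "x = 2 * w" by (auto elim: evenE)
    with x have "2 * w\<^sup>2 = 1" by (simp add: power_mult_distrib)
    then show False by presburger
  qed
  have "x\<^sup>2 + D * y\<^sup>2 \<noteq> 2" for x y
  proof
    assume xy: "x\<^sup>2 + D * y\<^sup>2 = 2"
    then have "y = 0" by (intro *[of x y]) simp
    with xy sq2[of x] show False by simp
  qed
  then have "reps D 2 = {}" by (auto simp: reps_def)
  ultimately show ?thesis by (simp add: nreps_def)
qed

text \<open>\<open>u / v\<close> is a square root of \<open>-D\<close> modulo
  \<open>p\<close>.\<close>

lemma split_prime_if_rep:
  fixes p u v :: int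
  assumes p: "prime p" and "p dvd u\<^sup>2 + D * v\<^sup>2" "\<not> p dvd v"
  shows "\<exists>k. p dvd k\<^sup>2 + D"
proof -
  have "coprime v p" using assms prime_imp_coprime coprime_commute by blast
  then obtain w where "[v * w = 1] (mod p)" using cong_solve_coprime_int by blast
  then have w: "p dvd v * w - 1" by (simp add: cong_iff_dvd_diff)
  have "p dvd (u\<^sup>2 + D * v\<^sup>2) * w\<^sup>2 - D * (v * w + 1) * (v * w - 1)"
    by (rule dvd_diff[OF dvd_mult2[OF assms(2)] dvd_mult[OF w]])
  also have "(u\<^sup>2 + D * v\<^sup>2) * w\<^sup>2 - D * (v * w + 1) * (v * w - 1) = (u * w)\<^sup>2 + D"
    by (simp add: power2_eq_square algebra_simps)
  finally show ?thesis by blast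
qed

text \<open>The primes \<open>q\<close> with \<open>2 * q\<close> among the above \<open>D\<close>. Since 2 is not a square modulo \<open>q\<close>, no number is
  represented by both \<open>X\<^sup>2 + 2 q Y\<^sup>2\<close> and \<open>2 X\<^sup>2 + q Y\<^sup>2\<close>.\<close>

definition genus_primes :: "nat set" where
  "genus_primes = {3, 5, 11, 29}"

lemma genus_primesD:
  assumes "q \<in> genus_primes"
  shows "prime q" "odd q" "2 * int q \<in> genus_discs"
    and "\<forall>z\<in>set [0..int q - 1]. (z\<^sup>2 - 2) mod int q \<noteq> 0"
proof -
  show "prime q" "odd q" "2 * int q \<in> genus_discs"
    using assms by (auto simp: genus_primes_def genus_discs_def)
  have "\<forall>z\<in>set [0..2]. (z\<^sup>2 - 2) mod 3 \<noteq> (0 :: int)" "\<forall>z\<in>set [0..4]. (z\<^sup>2 - 2) mod 5 \<noteq> (0 :: int)"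
    "\<forall>z\<in>set [0..10]. (z\<^sup>2 - 2) mod 11 \<noteq> (0 :: int)" "\<forall>z\<in>set [0..28]. (z\<^sup>2 - 2) mod 29 \<noteq> (0 :: int)"
    by (simp_all add: upto.simps del: set_upto)
  moreover have "q = 3 \<or> q = 5 \<or> q = 11 \<or> q = 29" using assms by (simp add: genus_primes_def)
  ultimately show "\<forall>z\<in>set [0..int q - 1]. (z\<^sup>2 - 2) mod int q \<noteq> 0"
    by (elim disjE; hypsubst; simp del: set_upto)
qed

text \<open>By exclusivity one summand of \<open>nreps\<close> vanishes, and the given
  representation tells which one survives. Both choices of \<open>M\<close> occur among the
  conics.\<close>

lemma card_reps_genus:
  assumes q: "q \<in> genus_primes" and N: "N > 0" and M: "M = int N \<or> M = 2 * int N"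
    and ne: "reps (2 * int q) M \<noteq> {}"
    and sep: "\<And>p. p \<in> prime_factors N \<Longrightarrow> separates A (2 * int q) p"
  shows "card (reps (2 * int q) M) = 2 * ndivisors_avoiding A N"
proof -
  have D: "2 * int q \<in> genus_discs" "2 * int q > 2"
    using q genus_primesD by (auto simp: genus_primes_def)
  have "reps (2 * int q) (int N) = {} \<or> reps (2 * int q) (2 * int N) = {}"
    using reps_exclusive[of "int q" N] genus_primesD[OF q] N by auto
  with M ne have eq: "nreps (2 * int q) (int N) = card (reps (2 * int q) M)"
    by (auto simp: nreps_def)
  moreover have "card (reps (2 * int q) M) \<noteq> 0" using ne finite_reps[of "2 * int q" M] D by simp
  ultimately have "nreps (2 * int q) (int N) \<noteq> 0" by simp
  from nreps_eq[OF D(1) N sep this] eq nreps_one[OF D(2)] show ?thesis by simp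
qed

section \<open>Congruences by which every conic point comes from a polygonal number\<close>

lemma four_dvd_square_diff:
  fixes x y :: int
  assumes "even (x\<^sup>2 - y\<^sup>2)" shows "4 dvd x\<^sup>2 - y\<^sup>2"
proof -
  have "even (x - y)" using assms by simp
  then have "even (x + y)" by simp
  with \<open>even (x - y)\<close> have "2 * 2 dvd (x - y) * (x + y)" by (rule mult_dvd_mono)
  then show "4 dvd x\<^sup>2 - y\<^sup>2" by (simp add: power2_eq_square algebra_simps)
qed

lemma odd_square_mod_8:
  fixes y :: int
  assumes "odd y" shows "8 dvd y\<^sup>2 - 1"
proof -
  obtain k where "y = 2 * k + 1" using assms by (auto elim: oddE)
  then have "y\<^sup>2 - 1 = 4 * (k * (k + 1))" by (simp add: power2_eq_square algebra_simps)
  moreover have "2 * 4 dvd k * (k + 1) * 4" by (intro mult_dvd_mono) simp_all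
  ultimately show ?thesis by (simp add: mult.commute)
qed

text \<open>Primality gives \<open>y\<close> congruent to \<open>k\<close> or \<open>-k\<close>
  modulo \<open>q\<close>; modulo \<open>r\<close> both hold, so one of them holds modulo
  \<open>r q\<close>.\<close>

lemma cong_pm_if_square_diff:
  fixes y k q r :: int
  assumes q: "prime q" "coprime r q" and "q dvd y\<^sup>2 - k\<^sup>2" "r dvd y - k" "r dvd y + k"
  shows "\<exists>c. y = r * q * c - k \<or> - y = r * q * c - k"
proof -
  have "q dvd (y - k) * (y + k)" using assms(3) by (simp add: power2_eq_square algebra_simps)
  then have "q dvd y - k \<or> q dvd y + k" using q(1) prime_dvd_multD by blast
  then have "r * q dvd y - k \<or> r * q dvd y + k" using assms by (auto intro: divides_mult)
  then show ?thesis
  proof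
    assume "r * q dvd y - k"
    then obtain c where "y - k = r * q * c" by (auto elim: dvdE)
    then show ?thesis by (intro exI[of _ "-c"]) simp
  next
    assume "r * q dvd y + k"
    then obtain c where "y + k = r * q * c" by (auto elim: dvdE)
    then show ?thesis by (intro exI[of _ c]) simp
  qed
qed

lemma rep_count_one:
  assumes q: "prime q" "odd q" and n: "n > 0"
    and d: "card (reps (2 * int q) (2 * int q * (int n)\<^sup>2 + (int q - 2)\<^sup>2)) = 2 * d"
  shows "int (rep_count (q + 2) 1 n) = \<lfloor>(real d - 1) / 2\<rfloor>"
proof -
  let ?k = "int q - 2" let ?E = "conic_points (q + 2) 1 n"
  let ?S = "reps (2 * int q) (2 * int q * (int n)\<^sup>2 + ?k\<^sup>2)"
  have q2: "q \<ge> 3" using q prime_ge_2_nat[of q] by (cases "q = 2") auto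
  have key: "even (x - int n) \<and> odd y \<and> int q dvd y\<^sup>2 - ?k\<^sup>2"
    if "y\<^sup>2 + 2 * int q * x\<^sup>2 = 2 * int q * (int n)\<^sup>2 + ?k\<^sup>2" for x y
  proof -
    have eq: "y\<^sup>2 - ?k\<^sup>2 = 2 * (int q * ((int n)\<^sup>2 - x\<^sup>2))" using that by (simp add: algebra_simps)
    then have "even (y\<^sup>2 - ?k\<^sup>2)" by simp
    then have "odd y" using q by simp
    \<comment> \<open>A difference of odd squares is divisible by 8, so 4 divides
      \<open>n^2 - x^2\<close> up to the odd factor \<open>q\<close>, and \<open>x\<close> has the
      parity of \<open>n\<close>.\<close>
    then have "8 dvd (y\<^sup>2 - 1) - (?k\<^sup>2 - 1)" using q by (intro dvd_diff odd_square_mod_8) auto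
    then have "2 * 4 dvd 2 * (int q * ((int n)\<^sup>2 - x\<^sup>2))" unfolding eq[symmetric] by simp
    then have "4 dvd int q * ((int n)\<^sup>2 - x\<^sup>2)" by (simp only: dvd_mult_cancel_left) simp
    then have "even (int q * ((int n)\<^sup>2 - x\<^sup>2))" by (rule dvd_trans[rotated]) simp
    then have "even (x - int n)" using q by simp
    with \<open>odd y\<close> eq show ?thesis by simp
  qed
  have E: "?E = (\<lambda>(y, x). (x, y)) ` ?S"
    using key by (force simp: conic_points_def reps_def algebra_simps)
  have "inj_on (\<lambda>(y, x). (x, y)) ?S" by (auto intro!: inj_onI)
  then have "card ?E = 2 * d" unfolding E using d by (simp add: card_image)
  moreover have "\<exists>c. y = 2 * (int (q + 2) - 2) * c - (int (q + 2) - 4) \<or>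
      - y = 2 * (int (q + 2) - 2) * c - (int (q + 2) - 4)" if "(x, y) \<in> ?E" for x y
  proof -
    have "(y, x) \<in> ?S" using that unfolding E by auto
    with key have "odd y" "int q dvd y\<^sup>2 - ?k\<^sup>2" by auto
    then have "\<exists>c. y = 2 * int q * c - ?k \<or> - y = 2 * int q * c - ?k"
      using q by (intro cong_pm_if_square_diff) (auto simp: coprime_left_2_iff_odd)
    then show ?thesis by simp
  qed
  ultimately show ?thesis using q2 n by (intro rep_count_eq_floor) auto
qed

text \<open>Here \<open>2 (m - 2) = 4 q\<close>, so \<open>y\<close> is needed modulo
  \<open>4 q\<close>. Since \<open>m - 4 = 2 q - 2\<close> is divisible by 4, it suffices that the
  equation forces \<open>4 dvd y\<close>.\<close>

lemma rep_count_two: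
  assumes q: "prime q" "odd q" and n: "n > 0"
    and d: "card (reps (2 * int q) (2 * int q * (int n)\<^sup>2 + (2 * int q - 2)\<^sup>2)) = 2 * d"
  shows "int (rep_count (2 * q + 2) 2 n) = \<lfloor>(real d - 1) / 2\<rfloor>"
proof -
  let ?k = "2 * int q - 2" let ?E = "conic_points (2 * q + 2) 2 n"
  let ?S = "reps (2 * int q) (2 * int q * (int n)\<^sup>2 + ?k\<^sup>2)"
  have q2: "q \<ge> 3" using q prime_ge_2_nat[of q] by (cases "q = 2") auto
  have k4: "4 dvd ?k"
  proof -
    have "2 * 2 dvd 2 * (int q - 1)" using q by (intro mult_dvd_mono) auto
    then show ?thesis by (simp add: algebra_simps)
  qed
  have key: "even (x - int n) \<and> 4 dvd y \<and> int q dvd y\<^sup>2 - ?k\<^sup>2"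
    if "y\<^sup>2 + 2 * int q * x\<^sup>2 = 2 * int q * (int n)\<^sup>2 + ?k\<^sup>2" for x y
  proof -
    have eq: "y\<^sup>2 - ?k\<^sup>2 = 2 * (int q * ((int n)\<^sup>2 - x\<^sup>2))" using that by (simp add: algebra_simps)
    then have "even (y\<^sup>2 - ?k\<^sup>2)" by simp
    then have "even y" by simp
    then obtain z where z: "y = 2 * z" by (auto elim: evenE)
    obtain l where l: "?k = 4 * l" using k4 by (auto elim: dvdE)
    have eq2: "2 * (z\<^sup>2 - 4 * l\<^sup>2) = int q * ((int n)\<^sup>2 - x\<^sup>2)"
      using eq unfolding l z by (simp add: power_mult_distrib)
    then have "even (int q * ((int n)\<^sup>2 - x\<^sup>2))" by (metis dvd_triv_left)
    then have e: "even ((int n)\<^sup>2 - x\<^sup>2)" using q by simp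
    have "4 dvd int q * ((int n)\<^sup>2 - x\<^sup>2)" using four_dvd_square_diff[OF e] by simp
    then have "2 * 2 dvd 2 * (z\<^sup>2 - 4 * l\<^sup>2)" unfolding eq2 by simp
    then have "even (z\<^sup>2 - 4 * l\<^sup>2)" by (simp only: dvd_mult_cancel_left) simp
    then have "even z" by simp
    then have "4 dvd y" unfolding z by (auto elim!: evenE)
    with e eq show ?thesis by simp
  qed
  have E: "?E = (\<lambda>(y, x). (x, y)) ` ?S"
    using key by (force simp: conic_points_def reps_def algebra_simps)
  have "inj_on (\<lambda>(y, x). (x, y)) ?S" by (auto intro!: inj_onI)
  then have "card ?E = 2 * d" unfolding E using d by (simp add: card_image)
  moreover have "\<exists>c. y = 2 * (int (2 * q + 2) - 2) * c - (int (2 * q + 2) - 4) \<or>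
      - y = 2 * (int (2 * q + 2) - 2) * c - (int (2 * q + 2) - 4)" if "(x, y) \<in> ?E" for x y
  proof -
    have "(y, x) \<in> ?S" using that unfolding E by auto
    with key have y: "4 dvd y" "int q dvd y\<^sup>2 - ?k\<^sup>2" by auto
    have "coprime 4 (int q)" using q coprime_power_left_iff[of 2 2 "int q"] by (simp add: coprime_left_2_iff_odd)
    from cong_pm_if_square_diff[OF _ this y(2) dvd_diff[OF y(1) k4] dvd_add[OF y(1) k4]] q
    have "\<exists>c. y = 4 * int q * c - ?k \<or> - y = 4 * int q * c - ?k" by simp
    then show ?thesis by simp
  qed
  ultimately show ?thesis using q2 n by (intro rep_count_eq_floor) auto
qed

text \<open>For \<open>m = 3\<close> the substitution is \<open>y = 2 c + 1\<close>, so oddness of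
  \<open>y\<close> suffices.\<close>

lemma rep_count_triangular:
  assumes t: "odd t" and n: "n > 0"
    and d: "card (reps (2 * int t) (2 * (2 * (int n)\<^sup>2 + int t))) = 2 * d"
  shows "int (rep_count 3 t n) = \<lfloor>(real d - 1) / 2\<rfloor>"
proof -
  let ?E = "conic_points 3 t n"
  have key: "even (x - int n) \<and> odd y" if "2 * x\<^sup>2 + int t * y\<^sup>2 = 2 * (int n)\<^sup>2 + int t" for x y
  proof -
    have "odd (2 * (int n)\<^sup>2 + int t)" using t by simp
    then have "odd y" unfolding that[symmetric] by auto
    have eq: "int t * (y\<^sup>2 - 1) = 2 * ((int n)\<^sup>2 - x\<^sup>2)" using that by (simp add: algebra_simps)
    have "8 dvd int t * (y\<^sup>2 - 1)" using odd_square_mod_8[OF \<open>odd y\<close>] by simp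
    then have "2 * 4 dvd 2 * ((int n)\<^sup>2 - x\<^sup>2)" unfolding eq by simp
    then have "4 dvd (int n)\<^sup>2 - x\<^sup>2" by (simp only: dvd_mult_cancel_left) simp
    then have "even ((int n)\<^sup>2 - x\<^sup>2)" by (rule dvd_trans[rotated]) simp
    with \<open>odd y\<close> show ?thesis by simp
  qed
  have "?E = {(x, y). 2 * x\<^sup>2 + int t * y\<^sup>2 = 2 * (int n)\<^sup>2 + int t}"
    using key by (auto simp: conic_points_def)
  then have "card ?E = 2 * d" using d card_reps_two_mult[of "int t" "2 * (int n)\<^sup>2 + int t"] by simp
  moreover have "\<exists>c. y = 2 * (int 3 - 2) * c - (int 3 - 4) \<or> - y = 2 * (int 3 - 2) * c - (int 3 - 4)"
    if "(x, y) \<in> ?E" for x y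
  proof -
    have "odd y" using that key by (auto simp: conic_points_def)
    then show ?thesis by (auto elim!: oddE)
  qed
  ultimately show ?thesis using t n by (intro rep_count_eq_floor) (auto intro: Nat.gr0I)
qed

section \<open>The fourteen identities\<close>

lemma separates_split:
  assumes p: "prime p" "odd p" "p \<notin> A" and q: "prime q"
    and dvd: "int p dvd k\<^sup>2 + 2 * int q * v\<^sup>2" and k: "\<not> int p dvd k"
  shows "separates A (2 * int q) p"
proof -
  have "\<not> int p dvd k\<^sup>2" using k p(1) prime_dvd_power[of "int p" k 2] by auto
  then have "\<not> int p dvd 2 * int q * v\<^sup>2" using dvd dvd_add_left_iff by blast
  then have "\<not> int p dvd 2 * int q" "\<not> int p dvd v" by (auto simp: power2_eq_square)
  with split_prime_if_rep[OF _ dvd] p show ?thesis by (simp add: separates_def)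
qed

text \<open>The trivial point \<open>(q - 2, n)\<close> serves twice: it selects the form, and it
  shows that primes of \<open>N\<close> outside \<open>A\<close> split. \<open>A\<close> absorbs the
  primes dividing its first coordinate.\<close>

lemma rep_count_one_eq:
  assumes q: "q \<in> genus_primes" and n: "n > 0"
    and A: "\<And>p. p \<in> A \<Longrightarrow> inert (2 * int q) (int p)"
      "\<And>p. prime p \<Longrightarrow> p dvd q - 2 \<Longrightarrow> p \<in> A"
  shows "int (rep_count (q + 2) 1 n) = \<lfloor>(real (ndivisors_avoiding A (2 * q * n\<^sup>2 + (q - 2)\<^sup>2)) - 1) / 2\<rfloor>"
proof (rule rep_count_one)
  note Q = genus_primesD[OF q]
  show "prime q" "odd q" "n > 0" by fact+
  define N where "N = 2 * q * n\<^sup>2 + (q - 2)\<^sup>2"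
  have "q \<ge> 3" using q by (auto simp: genus_primes_def)
  then have q2: "int (q - 2) = int q - 2" by simp
  then have iN: "int N = 2 * int q * (int n)\<^sup>2 + (int q - 2)\<^sup>2" by (simp add: N_def)
  have "odd N" using Q(2) \<open>q \<ge> 3\<close> by (simp add: N_def)
  have "N > 0" using n \<open>q \<ge> 3\<close> by (simp add: N_def)
  have "(int q - 2, int n) \<in> reps (2 * int q) (int N)" by (simp add: iN)
  then have ne: "reps (2 * int q) (int N) \<noteq> {}" by blast
  have "separates A (2 * int q) p" if "p \<in> prime_factors N" for p
  proof (cases "p \<in> A")
    case False
    have p: "prime p" "p dvd N" using that by auto
    then have "odd p" using \<open>odd N\<close> dvd_trans by blast
    moreover have "\<not> int p dvd int (q - 2)" using A(2) p False by (auto simp only: int_dvd_int_iff)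
    moreover have "int p dvd int N" using p by simp
    then have "int p dvd (int (q - 2))\<^sup>2 + 2 * int q * (int n)\<^sup>2" unfolding iN q2 by (simp add: add.commute)
    ultimately show ?thesis using p False Q(1) by (intro separates_split)
  qed (use A(1) in \<open>simp add: separates_def\<close>)
  from card_reps_genus[OF q \<open>N > 0\<close> _ ne this]
  show "card (reps (2 * int q) (2 * int q * (int n)\<^sup>2 + (int q - 2)\<^sup>2)) = 2 * ndivisors_avoiding A N"
    by (simp add: iN)
qed

text \<open>The trivial point \<open>(2 q - 2, n)\<close> now represents \<open>2 N\<close>; the
  prime 2 lies in \<open>A\<close> as a divisor of \<open>2 q - 2\<close>.\<close>

lemma rep_count_two_eq:
  assumes q: "q \<in> genus_primes" and n: "n > 0"
    and A: "\<And>p. p \<in> A \<Longrightarrow> p = 2 \<or> inert (2 * int q) (int p)"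
      "\<And>p. prime p \<Longrightarrow> p dvd 2 * q - 2 \<Longrightarrow> p \<in> A"
  shows "int (rep_count (2 * q + 2) 2 n) = \<lfloor>(real (ndivisors_avoiding A (q * n\<^sup>2 + 2 * (q - 1)\<^sup>2)) - 1) / 2\<rfloor>"
proof (rule rep_count_two)
  note Q = genus_primesD[OF q]
  show "prime q" "odd q" "n > 0" by fact+
  define N where "N = q * n\<^sup>2 + 2 * (q - 1)\<^sup>2"
  have "q \<ge> 3" using q by (auto simp: genus_primes_def)
  then have q1: "int (q - 1) = int q - 1" and q2: "int (2 * q - 2) = 2 * int q - 2" by simp_all
  have iN: "2 * int N = 2 * int q * (int n)\<^sup>2 + (2 * int q - 2)\<^sup>2"
    unfolding N_def of_nat_add of_nat_mult of_nat_power q1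
    by (simp add: power2_eq_square algebra_simps)
  have "N > 0" using n \<open>q \<ge> 3\<close> by (simp add: N_def)
  have "(2 * int q - 2, int n) \<in> reps (2 * int q) (2 * int N)" by (simp add: iN)
  then have ne: "reps (2 * int q) (2 * int N) \<noteq> {}" by blast
  have "separates A (2 * int q) p" if "p \<in> prime_factors N" for p
  proof (cases "p \<in> A")
    case False
    have p: "prime p" "p dvd N" using that by auto
    have "p \<noteq> 2" using A(2)[of 2] \<open>q \<ge> 3\<close> False by auto
    then have "odd p" using primes_dvd_imp_eq[OF two_is_prime_nat p(1)] by auto
    moreover have "\<not> int p dvd int (2 * q - 2)" using A(2) p False by (auto simp only: int_dvd_int_iff)
    moreover have "int p dvd 2 * int N" using p by simp
    then have "int p dvd (int (2 * q - 2))\<^sup>2 + 2 * int q * (int n)\<^sup>2" unfolding iN q2 by (simp add: add.commute)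
    ultimately show ?thesis using p False Q(1) by (intro separates_split)
  qed (use A(1) in \<open>auto simp: separates_def\<close>)
  from card_reps_genus[OF q \<open>N > 0\<close> _ ne this]
  show "card (reps (2 * int q) (2 * int q * (int n)\<^sup>2 + (2 * int q - 2)\<^sup>2)) = 2 * ndivisors_avoiding A N"
    by (simp add: iN)
qed

text \<open>The trivial point is \<open>(2 n, 1)\<close>, representing \<open>2 N\<close>; the only
  prime set aside is the ramified \<open>q\<close>.\<close>

lemma rep_count_triangular_eq:
  assumes q: "q \<in> genus_primes" and n: "n > 0"
  shows "int (rep_count 3 q n) = \<lfloor>(real (ndivisors_avoiding {q} (2 * n\<^sup>2 + q)) - 1) / 2\<rfloor>"
proof (rule rep_count_triangular)
  note Q = genus_primesD[OF q]
  show "odd q" "n > 0" by fact+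
  define N where "N = 2 * n\<^sup>2 + q"
  have iN: "2 * int N = (2 * int n)\<^sup>2 + 2 * int q * 1\<^sup>2" by (simp add: N_def power2_eq_square)
  have "N > 0" "odd N" using n Q(2) by (simp_all add: N_def)
  have "(2 * int n, 1) \<in> reps (2 * int q) (2 * int N)" by (simp add: iN)
  then have ne: "reps (2 * int q) (2 * int N) \<noteq> {}" by blast
  have "separates {q} (2 * int q) p" if "p \<in> prime_factors N" for p
  proof (cases "p \<in> {q}")
    case False
    have p: "prime p" "p dvd N" using that by auto
    have "odd p" using p \<open>odd N\<close> dvd_trans by blast
    moreover have "\<not> p dvd 2 * n"
    proof
      assume "p dvd 2 * n"
      then have "p dvd 2 * n * n" by simp
      then have "p dvd q" using p(2) unfolding N_def by (simp add: power2_eq_square dvd_add_right_iff mult.assoc)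
      with p(1) Q(1) False show False using primes_dvd_imp_eq by blast
    qed
    then have "\<not> int p dvd 2 * int n" by (metis int_dvd_int_iff of_nat_mult of_nat_numeral)
    moreover have "int p dvd (2 * int n)\<^sup>2 + 2 * int q * 1\<^sup>2" using p unfolding iN[symmetric] by simp
    ultimately show ?thesis using p False Q(1) by (intro separates_split)
  qed (simp add: separates_def)
  from card_reps_genus[OF q \<open>N > 0\<close> _ ne this]
  show "card (reps (2 * int q) (2 * (2 * (int n)\<^sup>2 + int q))) = 2 * ndivisors_avoiding {q} N"
    by (simp add: N_def)
qed

lemma card_reps_nonzero:
  assumes "D > 0" "(x, y) \<in> reps D M" shows "card (reps D M) \<noteq> 0"
  using assms(2) finite_reps[OF assms(1), of M] unfolding card_eq_0_iff by blast

text \<open>For \<open>D = 2\<close> the two forms differ only by swapping variables, so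
  \<open>nreps\<close> is twice the wanted count, and \<open>nreps 2 1 = 4\<close>.\<close>

lemma rep_count_triangular_one:
  assumes n: "n > 0"
  shows "int (rep_count 3 1 n) = \<lfloor>(real (ndivisors (2 * n\<^sup>2 + 1)) - 1) / 2\<rfloor>"
proof (rule rep_count_triangular)
  show "odd (1 :: nat)" "n > 0" using n by simp_all
  define N where "N = 2 * n\<^sup>2 + 1"
  have iN: "2 * int N = (2 * int n)\<^sup>2 + 2" by (simp add: N_def power2_eq_square)
  have two: "card (reps 2 (2 * K)) = card (reps 2 K)" for K
  proof -
    have "reps 2 K = prod.swap ` {(x, y). 2 * x\<^sup>2 + 1 * y\<^sup>2 = K}"
      by (auto simp: add.commute)
    then have "card (reps 2 K) = card {(x, y). 2 * x\<^sup>2 + 1 * y\<^sup>2 = K}"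
      by (simp only: card_image[OF inj_swap])
    then show ?thesis using card_reps_two_mult[of 1 K] by simp
  qed
  have "x\<^sup>2 + 2 * y\<^sup>2 = 1 \<longleftrightarrow> y = 0 \<and> (x = 1 \<or> x = -1)" for x y :: int
  proof
    assume xy: "x\<^sup>2 + 2 * y\<^sup>2 = 1"
    then have "y\<^sup>2 = 0" using zero_le_power2[of x] zero_le_power2[of y] by linarith
    with xy show "y = 0 \<and> (x = 1 \<or> x = -1)" by (simp add: power2_eq_1_iff)
  qed auto
  then have "reps 2 1 = {(1, 0), (-1, 0)}" by (auto simp: reps_def)
  then have one: "nreps 2 1 = 4" using two[of 1] by (simp add: nreps_def)
  have "(2 * int n, 1) \<in> reps 2 (2 * int N)" by (simp add: iN)
  then have "card (reps 2 (2 * int N)) \<noteq> 0" by (rule card_reps_nonzero[rotated]) simp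
  then have nz: "nreps 2 (int N) \<noteq> 0" by (simp add: nreps_def)
  have D: "2 \<in> genus_discs" by (simp add: genus_discs_def)
  have "separates {} 2 p" if "p \<in> prime_factors N" for p
  proof -
    have p: "prime p" "p dvd N" using that by auto
    have "odd N" by (simp add: N_def)
    then have "odd p" using p dvd_trans by blast
    moreover have "int p dvd 2 * int N" using p by simp
    then have "\<exists>k. int p dvd k\<^sup>2 + 2" unfolding iN by blast
    moreover have "\<not> p dvd 2" using primes_dvd_imp_eq[OF p(1) two_is_prime_nat] \<open>odd p\<close> by auto
    then have "\<not> int p dvd 2" by (metis int_dvd_int_iff of_nat_numeral)
    ultimately show ?thesis by (simp add: separates_def)
  qed
  from nreps_eq[OF D _ this nz] have "nreps 2 (int N) = 4 * ndivisors N"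
    by (simp add: one N_def ndivisors_eq_avoiding)
  then show "card (reps (2 * int 1) (2 * (2 * (int n)\<^sup>2 + int 1))) = 2 * ndivisors N"
    using two[of "int N"] by (simp add: nreps_def N_def add.commute)
qed

section \<open>Twice triangular numbers and sums of two squares\<close>

lemma not_square_Suc:
  fixes y n :: int
  assumes "n > 0" shows "y\<^sup>2 \<noteq> n\<^sup>2 + 1"
proof
  assume eq: "y\<^sup>2 = n\<^sup>2 + 1"
  have "n\<^sup>2 < \<bar>y\<bar>\<^sup>2" using eq by simp
  then have "n < \<bar>y\<bar>" using power2_less_imp_less by fastforce
  then have "(n + 1)\<^sup>2 \<le> \<bar>y\<bar>\<^sup>2" using assms by (intro power_mono) auto
  then show False using eq assms by (simp add: power2_eq_square algebra_simps)
qed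

lemma ndivisors_square_plus_one:
  "ndivisors (n\<^sup>2 + 1) = (if even n then 1 else 2) * ndivisors_avoiding {2} (n\<^sup>2 + 1)"
proof -
  have odd_case: "ndivisors M = ndivisors_avoiding {2} M" if "odd M" for M
  proof -
    have "prime_factors M - {2} = prime_factors M" using that by (auto dest: in_prime_factors_imp_dvd)
    moreover have "M > 0" using that by (auto intro: Nat.gr0I)
    ultimately show ?thesis by (simp add: ndivisors_eq_avoiding ndivisors_avoiding_def)
  qed
  show ?thesis
  proof (cases "even n")
    case False
    then obtain k where "n = 2 * k + 1" by (rule oddE)
    define M where "M = 2 * (k\<^sup>2 + k) + 1"
    have N: "n\<^sup>2 + 1 = 2 ^ 1 * M"
      using \<open>n = 2 * k + 1\<close> by (simp add: M_def power2_eq_square algebra_simps)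
    have M: "odd M" "M > 0" by (simp_all add: M_def)
    have "ndivisors (n\<^sup>2 + 1) = 2 * ndivisors M"
      unfolding N using M ndivisors_prime_power_mult[of 2 M 1] by simp
    moreover have "ndivisors_avoiding {2} (n\<^sup>2 + 1) = ndivisors_avoiding {2} M"
      unfolding N using M ndivisors_avoiding_prime_power_mult[of 2 M "{2}" 1] by simp
    ultimately show ?thesis using False odd_case[OF M(1)] by simp
  qed (simp add: odd_case)
qed

text \<open>For \<open>D = 1\<close> the map to \<open>(x + y, x - y)\<close> equates the counts for
  \<open>K\<close> and \<open>2 K\<close>. Thus \<open>nreps\<close> is twice the count, and the
  four representations of 1 give the constant 8.\<close>

lemma card_reps_sum_two_squares:
  "card (reps 1 (int (n\<^sup>2 + 1))) = 4 * ndivisors_avoiding {2} (n\<^sup>2 + 1)"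
proof -
  define N where "N = n\<^sup>2 + 1"
  have two: "card (reps 1 (2 * K)) = card (reps 1 K)" for K
  proof -
    have "reps 1 (2 * K) = (\<lambda>(x, y). (x + y, x - y)) ` reps 1 K"
    proof (intro equalityI subsetI)
      fix z assume "z \<in> reps 1 (2 * K)"
      moreover obtain x y where z: "z = (x, y)" by (cases z)
      ultimately have eq: "x\<^sup>2 + y\<^sup>2 = 2 * K" by simp
      then have "even (x\<^sup>2 + y\<^sup>2)" by simp
      then have "even (x + y)" by simp
      then obtain a where a: "x + y = 2 * a" by (rule evenE)
      define b where "b = x - a"
      have xy: "x = a + b" "y = a - b" using a by (simp_all add: b_def)
      have "a\<^sup>2 + b\<^sup>2 = K" using eq unfolding xy by (simp add: power2_eq_square algebra_simps)
      then have "(a, b) \<in> reps 1 K" by simp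
      then show "z \<in> (\<lambda>(x, y). (x + y, x - y)) ` reps 1 K" unfolding z xy by force
    qed (auto simp: power2_eq_square algebra_simps)
    moreover have "inj_on (\<lambda>(x :: int, y). (x + y, x - y)) (reps 1 K)" by (auto intro!: inj_onI)
    ultimately show ?thesis by (simp add: card_image)
  qed
  have "x\<^sup>2 + y\<^sup>2 = 1 \<longleftrightarrow> (x, y) \<in> {(1, 0), (-1, 0), (0, 1), (0, -1)}" for x y :: int
  proof
    assume xy: "x\<^sup>2 + y\<^sup>2 = 1"
    then have "x\<^sup>2 = 0 \<or> x\<^sup>2 = 1"
      using zero_le_power2[of x] zero_le_power2[of y] by linarith
    with xy show "(x, y) \<in> {(1, 0), (-1, 0), (0, 1), (0, -1)}" by (auto simp: power2_eq_1_iff)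
  qed auto
  then have "reps 1 1 = {(1, 0), (-1, 0), (0, 1), (0, -1)}" by (auto simp: reps_def)
  then have one: "nreps 1 1 = 8" using two[of 1] by (simp add: nreps_def)
  have "(int n, 1) \<in> reps 1 (int N)" by (simp add: N_def)
  then have "card (reps 1 (int N)) \<noteq> 0" by (rule card_reps_nonzero[rotated]) simp
  then have nz: "nreps 1 (int N) \<noteq> 0" by (simp add: nreps_def)
  have D: "1 \<in> genus_discs" by (simp add: genus_discs_def)
  have "separates {2} 1 p" if "p \<in> prime_factors N" for p
  proof (cases "p = 2")
    case False
    have p: "prime p" "p dvd N" using that by auto
    have "odd p" using False primes_dvd_imp_eq[OF two_is_prime_nat p(1)] by auto
    moreover have "int p dvd int N" using p by simp
    then have "int p dvd (int n)\<^sup>2 + 1" by (simp add: N_def add.commute)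
    then have "\<exists>k. int p dvd k\<^sup>2 + 1" by blast
    ultimately show ?thesis using prime_gt_1_nat[OF p(1)] False by (simp add: separates_def)
  qed (simp add: separates_def)
  from nreps_eq[OF D _ this nz] have "nreps 1 (int N) = 8 * ndivisors_avoiding {2} N"
    by (simp add: one N_def)
  then show ?thesis using two[of "int N"] by (simp add: nreps_def N_def)
qed

text \<open>For odd \<open>n\<close> the parity condition is automatic. For even \<open>n\<close>
  exactly one coordinate is even, so swapping shows that half of the representations qualify. This
  balances the factor of the prime 2 in the divisor count.\<close>

lemma card_conic_points_sum_two_squares:
  "card (conic_points 3 2 n) = 2 * ndivisors (n\<^sup>2 + 1)"
proof -
  let ?N = "(int n)\<^sup>2 + 1" let ?E = "conic_points 3 2 n"
  have E: "?E = {(x, y). x\<^sup>2 + y\<^sup>2 = ?N \<and> even (x - int n)}"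
    by (auto simp: conic_points_def)
  have ES: "?E = {z \<in> reps 1 ?N. even (fst z - int n)}" unfolding E reps_def by auto
  have card_S: "card (reps 1 ?N) = 4 * ndivisors_avoiding {2} (n\<^sup>2 + 1)"
    using card_reps_sum_two_squares[of n] by (simp add: add.commute)
  have fin: "finite (reps 1 ?N)" by (simp add: finite_reps)
  show ?thesis
  proof (cases "even n")
    case True
    have par: "even x \<longleftrightarrow> odd y" if "x\<^sup>2 + y\<^sup>2 = ?N" for x y
    proof -
      have "odd (x\<^sup>2 + y\<^sup>2)" unfolding that using True by simp
      then show ?thesis by auto
    qed
    have swap: "(x, y) \<in> {z \<in> reps 1 ?N. odd (fst z - int n)} \<longleftrightarrow> (y, x) \<in> ?E" for x y
    proof -
      have "odd (x - int n) \<longleftrightarrow> even (y - int n)" if "x\<^sup>2 + y\<^sup>2 = ?N" using par[OF that] True by simp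
      then show ?thesis unfolding E by (simp add: add.commute[of "y\<^sup>2"]) blast
    qed
    have "{z \<in> reps 1 ?N. odd (fst z - int n)} = prod.swap ` ?E"
    proof (rule Set.set_eqI)
      fix z :: "int \<times> int"
      obtain x y where z: "z = (x, y)" by (cases z)
      show "z \<in> {z \<in> reps 1 ?N. odd (fst z - int n)} \<longleftrightarrow> z \<in> prod.swap ` ?E"
        unfolding z pair_in_swap_image by (rule swap)
    qed
    then have "card {z \<in> reps 1 ?N. odd (fst z - int n)} = card ?E"
      by (simp only: card_image[OF inj_swap])
    moreover have "reps 1 ?N = ?E \<union> {z \<in> reps 1 ?N. odd (fst z - int n)}" unfolding ES by blast
    then have "card (reps 1 ?N) = card ?E + card {z \<in> reps 1 ?N. odd (fst z - int n)}"
      using fin by (subst card_Un_disjoint[symmetric]) (auto simp: ES)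
    ultimately show ?thesis using card_S ndivisors_square_plus_one[of n] True by simp
  next
    case False
    have "odd x" if "x\<^sup>2 + y\<^sup>2 = ?N" for x y
    proof
      assume "even x"
      have "even (x\<^sup>2 + y\<^sup>2)" unfolding that using False by simp
      with \<open>even x\<close> have "even y" by simp
      with \<open>even x\<close> have "2\<^sup>2 dvd x\<^sup>2" "2\<^sup>2 dvd y\<^sup>2" by (simp_all only: pow_divides_pow_iff zero_less_numeral)
      then have "4 dvd x\<^sup>2 + y\<^sup>2" by simp
      then have "4 dvd ((int n)\<^sup>2 - 1) + 2" unfolding that by (simp add: add.commute)
      moreover have "8 dvd (int n)\<^sup>2 - 1" using False by (intro odd_square_mod_8) simp
      then have "4 dvd (int n)\<^sup>2 - 1" by (rule dvd_trans[rotated]) simp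
      ultimately have "4 dvd (2 :: int)" using dvd_add_right_iff by blast
      then show False by simp
    qed
    then have "?E = reps 1 ?N" unfolding ES using False by (auto simp: reps_def)
    then show ?thesis using card_S ndivisors_square_plus_one[of n] False by simp
  qed
qed

lemma rep_count_triangular_two:
  assumes n: "n > 0"
  shows "real (rep_count 3 2 n) = real (ndivisors (n\<^sup>2 + 1)) / 2 - 1"
proof -
  let ?E = "conic_points 3 2 n"
  have eq: "(x, y) \<in> ?E \<Longrightarrow> x\<^sup>2 + y\<^sup>2 = (int n)\<^sup>2 + 1 \<and> even (x - int n)" for x y
    by (simp add: conic_points_def)
  have H: "\<exists>c. y = 2 * (int 3 - 2) * c - (int 3 - 4) \<or> - y = 2 * (int 3 - 2) * c - (int 3 - 4)"
    if "(x, y) \<in> ?E" for x y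
  proof -
    have "even x \<longleftrightarrow> even (int n)" using eq[OF that] by simp
    moreover have "y\<^sup>2 = (int n)\<^sup>2 + 1 - x\<^sup>2" using eq[OF that] by simp
    ultimately have "odd (y\<^sup>2)" by simp
    then have "odd y" by simp
    then show ?thesis by (auto elim!: oddE)
  qed
  \<comment> \<open>\<open>x = 0\<close> would make \<open>n^2 + 1\<close> a square, so the
    correction term vanishes and the formula is exact.\<close>
  have "(0, y) \<notin> ?E" for y using eq[of 0 y] not_square_Suc[of "int n" y] n by auto
  then have "0 \<notin> fst ` ?E" by auto
  with card_conic_points[of 3 2 n, OF _ _ _ n H] card_conic_points_sum_two_squares[of n]
  have "ndivisors (n\<^sup>2 + 1) = 2 * rep_count 3 2 n + 2" by simp
  then have "real (ndivisors (n\<^sup>2 + 1)) = 2 * real (rep_count 3 2 n) + 2" by simp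
  then show ?thesis by linarith
qed

theorem theorem3:
  fixes n :: nat
  assumes "n > 0"
  shows
    "int (rep_count 3 1 n) = \<lfloor>(real (ndivisors (2 * n^2 + 1)) - 1) / 2\<rfloor> \<and>
     int (rep_count 5 1 n) = \<lfloor>(real (ndivisors (6 * n^2 + 1)) - 1) / 2\<rfloor> \<and>
     int (rep_count 7 1 n) = \<lfloor>(real (ndivisors_avoiding {3} (10 * n^2 + 9)) - 1) / 2\<rfloor> \<and>
     int (rep_count 13 1 n) = \<lfloor>(real (ndivisors_avoiding {3} (22 * n^2 + 81)) - 1) / 2\<rfloor> \<and>
     int (rep_count 31 1 n) = \<lfloor>(real (ndivisors_avoiding {3} (58 * n^2 + 729)) - 1) / 2\<rfloor> \<and>
     real (rep_count 3 2 n) = real (ndivisors (n^2 + 1)) / 2 - 1 \<and>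
     int (rep_count 8 2 n) = \<lfloor>(real (ndivisors_avoiding {2} (3 * n^2 + 8)) - 1) / 2\<rfloor> \<and>
     int (rep_count 12 2 n) = \<lfloor>(real (ndivisors_avoiding {2} (5 * n^2 + 32)) - 1) / 2\<rfloor> \<and>
     int (rep_count 24 2 n) = \<lfloor>(real (ndivisors_avoiding {2, 5} (11 * n^2 + 200)) - 1) / 2\<rfloor> \<and>
     int (rep_count 60 2 n) = \<lfloor>(real (ndivisors_avoiding {2, 7} (29 * n^2 + 1568)) - 1) / 2\<rfloor> \<and>
     int (rep_count 3 3 n) = \<lfloor>(real (ndivisors_avoiding {3} (2 * n^2 + 3)) - 1) / 2\<rfloor> \<and>
     int (rep_count 3 5 n) = \<lfloor>(real (ndivisors_avoiding {5} (2 * n^2 + 5)) - 1) / 2\<rfloor> \<and>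
     int (rep_count 3 11 n) = \<lfloor>(real (ndivisors_avoiding {11} (2 * n^2 + 11)) - 1) / 2\<rfloor> \<and>
     int (rep_count 3 29 n) = \<lfloor>(real (ndivisors_avoiding {29} (2 * n^2 + 29)) - 1) / 2\<rfloor>"
proof -
  have q: "3 \<in> genus_primes" "5 \<in> genus_primes" "11 \<in> genus_primes" "29 \<in> genus_primes"
    by (simp_all add: genus_primes_def)
  have pr: "prime (3 :: nat)" "prime (5 :: nat)" "prime (7 :: nat)" by simp_all
  \<comment> \<open>The numbers 3, 9, 27 are the values of \<open>q - 2\<close> other than 1, and 4,
    8, 20, 56 the values of \<open>2 q - 2\<close>, for the four primes \<open>q\<close>.\<close>
  have fac: "p dvd 3 \<Longrightarrow> p = 3" "p dvd 9 \<Longrightarrow> p = 3" "p dvd 27 \<Longrightarrow> p = 3" "p dvd 4 \<Longrightarrow> p = 2"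
    "p dvd 8 \<Longrightarrow> p = 2" "p dvd 20 \<Longrightarrow> p = 2 \<or> p = 5" "p dvd 56 \<Longrightarrow> p = 2 \<or> p = 7" if p: "prime p" for p :: nat
  proof -
    note eq = primes_dvd_imp_eq[OF p]
    show 3: "p dvd 3 \<Longrightarrow> p = 3" by (rule eq[OF pr(1)])
    show 9: "p dvd 9 \<Longrightarrow> p = 3" using prime_dvd_mult_iff[OF p, of 3 3] 3 by auto
    show "p dvd 27 \<Longrightarrow> p = 3" using prime_dvd_mult_iff[OF p, of 3 9] 3 9 by auto
    have 2: "p dvd 2 \<Longrightarrow> p = 2" by (rule eq[OF two_is_prime_nat])
    show 4: "p dvd 4 \<Longrightarrow> p = 2" using prime_dvd_mult_iff[OF p, of 2 2] 2 by auto
    show 8: "p dvd 8 \<Longrightarrow> p = 2" using prime_dvd_mult_iff[OF p, of 2 4] 2 4 by auto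
    show "p dvd 20 \<Longrightarrow> p = 2 \<or> p = 5" using prime_dvd_mult_iff[OF p, of 4 5] 4 eq[OF pr(2)] by auto
    show "p dvd 56 \<Longrightarrow> p = 2 \<or> p = 7" using prime_dvd_mult_iff[OF p, of 8 7] 8 eq[OF pr(3)] by auto
  qed
  have 1: "int (rep_count 5 1 n) = \<lfloor>(real (ndivisors (6 * n^2 + 1)) - 1) / 2\<rfloor>"
    using rep_count_one_eq[OF q(1) assms, of "{}"] by (simp add: ndivisors_eq_avoiding)
  have 2: "int (rep_count 7 1 n) = \<lfloor>(real (ndivisors_avoiding {3} (10 * n^2 + 9)) - 1) / 2\<rfloor>"
    using rep_count_one_eq[OF q(2) assms, of "{3}"] inert_cases fac by simp
  have 3: "int (rep_count 13 1 n) = \<lfloor>(real (ndivisors_avoiding {3} (22 * n^2 + 81)) - 1) / 2\<rfloor>"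
    using rep_count_one_eq[OF q(3) assms, of "{3}"] inert_cases fac by simp
  have 4: "int (rep_count 31 1 n) = \<lfloor>(real (ndivisors_avoiding {3} (58 * n^2 + 729)) - 1) / 2\<rfloor>"
    using rep_count_one_eq[OF q(4) assms, of "{3}"] inert_cases fac by simp
  have 5: "int (rep_count 8 2 n) = \<lfloor>(real (ndivisors_avoiding {2} (3 * n^2 + 8)) - 1) / 2\<rfloor>"
    using rep_count_two_eq[OF q(1) assms, of "{2}"] fac by simp
  have 6: "int (rep_count 12 2 n) = \<lfloor>(real (ndivisors_avoiding {2} (5 * n^2 + 32)) - 1) / 2\<rfloor>"
    using rep_count_two_eq[OF q(2) assms, of "{2}"] fac by simp
  have 7: "int (rep_count 24 2 n) = \<lfloor>(real (ndivisors_avoiding {2, 5} (11 * n^2 + 200)) - 1) / 2\<rfloor>"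
  proof -
    have "p = 2 \<or> p = 5 \<Longrightarrow> p = 2 \<or> inert 22 (int p)" for p using inert_cases by auto
    then show ?thesis using rep_count_two_eq[OF q(3) assms, of "{2, 5}"] fac(6) by simp
  qed
  have 8: "int (rep_count 60 2 n) = \<lfloor>(real (ndivisors_avoiding {2, 7} (29 * n^2 + 1568)) - 1) / 2\<rfloor>"
  proof -
    have "p = 2 \<or> p = 7 \<Longrightarrow> p = 2 \<or> inert 58 (int p)" for p using inert_cases by auto
    then show ?thesis using rep_count_two_eq[OF q(4) assms, of "{2, 7}"] fac(7) by simp
  qed
  show ?thesis
    using rep_count_triangular_one[OF assms] rep_count_triangular_two[OF assms] 1 2 3 4 5 6 7 8
      q[THEN rep_count_triangular_eq, OF assms] by blast
qed

end
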